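(* Let $\mathcal{H}$ be a real Hilbert space and let $A,B:\mathcal{H}\rightrightarrows\mathcal{H}$ be maximally monotone operators such that $\operatorname{zer}(A+B)\neq\varnothing$. Consider the iterative scheme $$(\forall n\geq 1)\quad\left\{\begin{array}{l} y_n=J_{\gamma B}[x_n+\alpha_n(x_n-x_{n-1})]\\ z_n=J_{\gamma A}[2y_n-x_n-\alpha_n(x_n-x_{n-1})]\\ x_{n+1}=x_n+\alpha_n(x_n-x_{n-1})+\lambda_n(z_n-y_n) \end{array}\right.$$ where $\gamma>0$, $x_0,x_1$ are arbitrarily chosen in $\mathcal{H}$, $(\alpha_n)_{n\geq 1}$ is a nondecreasing sequence of real numbers with $\alpha_1=0$ and $0\leq\alpha_n\leq\alpha<1$ for every $n\geq 1$ (with $\alpha$ a real number), and $\lambda,\sigma,\delta>0$ and the real sequence $(\lambda_n)_{n\geq 1}$ are such that $$\delta>\frac{\alpha^2(1+\alpha)+\alpha\sigma}{1-\alpha^2}\quad\text{and}\quad 0<\lambda\leq\lambda_n\leq 2\,\frac{\delta-\alpha\big[\alpha(1+\alpha)+\alpha\delta+\sigma\big]}{\delta\big[1+\alpha(1+\alpha)+\alpha\delta+\sigma\big]}\quad\forall n\geq 1.$$ Then there exists $x\in\operatorname{Fix}(R_{\gamma A}R_{\gamma B})$ such that the following statements are true: (i) $J_{\gamma B}x\in\operatorname{zer}(A+B)$; (ii) $\sum_{n\in\mathbb{N}}\|x_{n+1}-x_n\|^2<+\infty$; (iii) $(x_n)_{n\in\mathbb{N}}$ converges weakly to $x$; (iv)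 $y_n-z_n\rightarrow 0$ as $n\rightarrow+\infty$; (v) $(y_n)_{n\geq 1}$ converges weakly to $J_{\gamma B}x$; (vi) $(z_n)_{n\geq 1}$ converges weakly to $J_{\gamma B}x$; (vii) if $A$ or $B$ is uniformly monotone, then $(y_n)_{n\geq 1}$ and $(z_n)_{n\geq 1}$ converge strongly to the unique point in $\operatorname{zer}(A+B)$.
   Context: $\mathbb{N}=\{0,1,2,\ldots\}$. For a set-valued operator $A:\mathcal{H}\rightrightarrows\mathcal{H}$: the graph is $\operatorname{Gr}A=\{(x,u)\in\mathcal{H}\times\mathcal{H}:u\in Ax\}$; the set of zeros is $\operatorname{zer}A=\{x\in\mathcal{H}:0\in Ax\}$. $A$ is monotone if $\langle x-y,u-v\rangle\geq 0$ for all $(x,u),(y,v)\in\operatorname{Gr}A$, and maximally monotone if moreover its graph has no proper monotone extension in $\mathcal{H}\times\mathcal{H}$. The resolvent of $A$ is $J_A=(\operatorname{Id}+A)^{-1}$ and the reflected resolvent is $R_A=2J_A-\operatorname{Id}$, where $\operatorname{Id}$ is the identity on $\mathcal{H}$; if $A$ is maximally monotone, $J_A$ is single-valued and defined on all of $\mathcal{H}$. $\operatorname{Fix}T$ is the set of fixed points of $T$. $A$ is uniformly monotone if there is an increasing function $\phi_A:[0,+\infty)\to[0,+\infty]$ that vanishes only at $0$ such that $\langle x-y,u-v\rangle\geq\phi_A(\|x-y\|)$ for all $(x,u),(y,v)\in\operatorname{Gr}A$. *)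

theory Defs
  imports "HOL-Analysis.Analysis"
begin

text \<open>Set-valued operators on \<open>'a\<close> are functions \<open>'a \<Rightarrow> 'a set\<close>; a real Hilbert space is a type of
  sort \<open>{real_inner, complete_space}\<close>.\<close>

definition gr :: "('a \<Rightarrow> 'a set) \<Rightarrow> ('a \<times> 'a) set" where
  "gr A = {(x, u). u \<in> A x}"

definition zer :: "('a::zero \<Rightarrow> 'a set) \<Rightarrow> 'a set" where
  "zer A = {x. 0 \<in> A x}"

definition op_plus :: "('a::plus \<Rightarrow> 'a set) \<Rightarrow> ('a \<Rightarrow> 'a set) \<Rightarrow> 'a \<Rightarrow> 'a set" where
  "op_plus A B = (\<lambda>x. {u + v |u v. u \<in> A x \<and> v \<in> B x})"

definition op_scale :: "real \<Rightarrow> ('a::real_vector \<Rightarrow> 'a set) \<Rightarrow> 'a \<Rightarrow> 'a set" where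
  "op_scale c A = (\<lambda>x. {c *\<^sub>R u |u. u \<in> A x})"

definition op_inverse :: "('a \<Rightarrow> 'a set) \<Rightarrow> 'a \<Rightarrow> 'a set" where
  "op_inverse A = (\<lambda>u. {x. u \<in> A x})"

definition op_id :: "'a \<Rightarrow> 'a set" where
  "op_id = (\<lambda>x. {x})"

definition monotone_op :: "('a::real_inner \<Rightarrow> 'a set) \<Rightarrow> bool" where
  "monotone_op A \<longleftrightarrow> (\<forall>(x, u) \<in> gr A. \<forall>(y, v) \<in> gr A. inner (x - y) (u - v) \<ge> 0)"

definition maximally_monotone :: "('a::real_inner \<Rightarrow> 'a set) \<Rightarrow> bool" where
  "maximally_monotone A \<longleftrightarrow>
     monotone_op A \<and> (\<forall>A'. monotone_op A' \<and> gr A \<subseteq> gr A' \<longrightarrow> gr A' = gr A)"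

text \<open>``Increasing'' is read in the weak sense, \<open>s \<le> t \<Longrightarrow> \<phi> s \<le> \<phi> t\<close>.
  Only the values of \<open>\<phi>\<close> on \<open>{0..}\<close> matter.\<close>

definition uniformly_monotone :: "('a::real_inner \<Rightarrow> 'a set) \<Rightarrow> bool" where
  "uniformly_monotone A \<longleftrightarrow>
     (\<exists>\<phi> :: real \<Rightarrow> ereal.
        mono_on {0..} \<phi> \<and> (\<forall>t\<ge>0. \<phi> t \<ge> 0) \<and> (\<forall>t\<ge>0. \<phi> t = 0 \<longleftrightarrow> t = 0) \<and>
        (\<forall>(x, u) \<in> gr A. \<forall>(y, v) \<in> gr A. ereal (inner (x - y) (u - v)) \<ge> \<phi> (norm (x - y))))"

text \<open>The set-valued resolvent \<open>(Id + A)\<^sup>-\<^sup>1\<close> is turned into a function by taking the unique element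
  of its values. This is meaningful at points where that value is a singleton, hence everywhere
  if \<open>A\<close> is maximally monotone on a Hilbert space (Minty).\<close>

definition resolvent :: "('a::real_inner \<Rightarrow> 'a set) \<Rightarrow> 'a \<Rightarrow> 'a" where
  "resolvent A x = the_elem (op_inverse (op_plus op_id A) x)"

definition reflected_resolvent :: "('a::real_inner \<Rightarrow> 'a set) \<Rightarrow> 'a \<Rightarrow> 'a" where
  "reflected_resolvent A x = 2 *\<^sub>R resolvent A x - x"

definition Fix :: "('a \<Rightarrow> 'a) \<Rightarrow> 'a set" where
  "Fix T = {x. T x = x}"

text \<open>Sequential convergence in the weak topology, i.e. the coarsest topology making all the
  functionals \<open>\<lambda>x. inner x v\<close> continuous.\<close>

definition weakly_converges :: "(nat \<Rightarrow> 'a::real_inner) \<Rightarrow> 'a \<Rightarrow> bool" where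
  "weakly_converges x l \<longleftrightarrow> (\<forall>v. (\<lambda>n. inner (x n) v) \<longlonglongrightarrow> inner l v)"

end

theory Submission
  imports Defs
begin

text \<open>
  Put \<open>w n = x n + \<alpha>\<^sub>n (x n - x (n - 1))\<close> and \<open>T = R\<^sub>A R\<^sub>B\<close>, with the reflected resolvents of \<open>\<gamma> A\<close> and
  \<open>\<gamma> B\<close>; let \<open>J\<^sub>B\<close> be the resolvent of \<open>\<gamma> B\<close>. Since \<open>T (w n) - w n = 2 (z n - y n)\<close>, the scheme is
  the iteration
  \<open>x (n + 1) = w n + (\<lambda>\<^sub>n / 2) (T (w n) - w n)\<close> of a nonexpansive map, relaxed with \<open>\<lambda>\<^sub>n / 2\<close> and
  extrapolated by an inertial term. The fixed points of \<open>T\<close> are the points \<open>p\<close> with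
  \<open>p - q \<in> \<gamma> B q\<close> and \<open>q - p \<in> \<gamma> A q\<close> for \<open>q = J\<^sub>B p\<close>; so \<open>q\<close> is a zero of \<open>A + B\<close>, and every zero arises
  in this way.

  Convergence of \<open>x\<close> is \<open>inertial_krasnoselskii_mann\<close>. The distance to a fixed point need not
  decrease along an inertial iteration, but \<open>\<parallel>x (n + 1) - p\<parallel>\<^sup>2\<close> corrected by multiples of
  \<open>\<parallel>x n - p\<parallel>\<^sup>2\<close> and \<open>\<parallel>x (n + 1) - x n\<parallel>\<^sup>2\<close> does. This yields summability of the squared increments,
  convergence of the distances to all fixed points, a vanishing residual \<open>T (w n) - w n\<close>, and by
  Opial's lemma the weak limit \<open>p\<close>.

  Resolvents need not be weakly continuous, so the weak limit of \<open>y\<close> needs a separate argument: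
  \<open>u n = 2 y n - w n - z n\<close> and \<open>v n = w n - y n\<close> are values of \<open>\<gamma> A\<close> at \<open>z n\<close> and of \<open>\<gamma> B\<close> at \<open>y n\<close>, and
  \<open>u n + v n = y n - z n\<close> tends to \<open>0\<close>. By \<open>maximally_monotone_sum_closed\<close> every weak cluster point \<open>r\<close> of
  \<open>y\<close> satisfies \<open>p - r \<in> \<gamma> B r\<close>, that is \<open>r = J\<^sub>B p\<close>. If one operator is uniformly monotone, the sum of
  the two monotonicity gaps against \<open>q\<close> tends to \<open>0\<close>, so each gap does, and the modulus forces strong
  convergence.

  Two facts about Hilbert spaces are derived on the way from one minimization principle, the lemma
  \<open>quadratic_minimizer\<close>: the Riesz representation theorem, which gives weak compactness of bounded
  sequences, and Minty's theorem, without which the resolvents would not be defined everywhere.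
\<close>

section \<open>Minimizing a convex function plus half the squared norm\<close>

text \<open>The pair \<open>(w0, t0)\<close> minimizes \<open>t + \<parallel>w\<parallel>\<^sup>2 / 2\<close> over \<open>E\<close>, and the inequality is the optimality
  condition at this point. If \<open>E\<close> is the epigraph of a convex lower semicontinuous function, which may
  take the value \<open>\<infinity>\<close>, this minimizes the function plus half the squared norm. Strong convexity makes
  every minimizing sequence Cauchy, so completeness replaces any compactness argument.\<close>
lemma quadratic_minimizer:
  fixes E :: "('b::{real_inner, complete_space} \<times> real) set"
  assumes "closed E" "convex E" "E \<noteq> {}"
    and bound: "\<And>w t. (w, t) \<in> E \<Longrightarrow> c \<le> t + (norm w)\<^sup>2 / 2"
  shows "\<exists>w0 t0. (w0, t0) \<in> E \<and>
    (\<forall>w t. (w, t) \<in> E \<longrightarrow> t0 + (norm w0)\<^sup>2 \<le> t + inner w0 w)"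
proof -
  define g where "g = (\<lambda>e :: 'b \<times> real. snd e + (norm (fst e))\<^sup>2 / 2)"
  define h where "h = Inf (g ` E)"
  have bdd: "bdd_below (g ` E)"
    using bound by (auto simp: g_def intro!: bdd_belowI[of _ c])
  have h_le: "h \<le> g e" if "e \<in> E" for e
    unfolding h_def using bdd that by (auto intro: cInf_lower)
  have "\<exists>e\<in>E. g e < h + 1 / Suc n" for n
    using cInf_lessD[of "g ` E" "h + 1 / Suc n"] assms(3) by (auto simp: h_def)
  then obtain e where eE: "\<And>n. e n \<in> E" and ge: "\<And>n. g (e n) < h + 1 / Suc n"
    by metis
  \<comment> \<open>The midpoint of two points of \<open>E\<close> lies in \<open>E\<close>, and the parallelogram law measures its gain.\<close>
  have mid: "(norm (fst (e n) - fst (e m)))\<^sup>2 \<le> 4 * (1 / Suc n + 1 / Suc m)" for n m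
  proof -
    have "(1/2) *\<^sub>R e n + (1/2) *\<^sub>R e m \<in> E"
      using convexD[OF assms(2) eE eE] by simp
    then have "h \<le> g ((1/2) *\<^sub>R e n + (1/2) *\<^sub>R e m)" by (rule h_le)
    also have "\<dots> = (g (e n) + g (e m)) / 2 - (norm (fst (e n) - fst (e m)))\<^sup>2 / 8"
      by (simp add: g_def power2_norm_eq_inner inner_add_left inner_add_right
          inner_diff_left inner_diff_right inner_commute field_simps)
    finally have *: "h \<le> (g (e n) + g (e m)) / 2 - (norm (fst (e n) - fst (e m)))\<^sup>2 / 8" .
    have "d \<le> 4 * (r + s)" if "h \<le> (a + b) / 2 - d / 8" "a < h + r" "b < h + s" for a b d r s :: real
      using that by (simp add: field_simps)
    from this[OF * ge ge] show ?thesis .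
  qed
  have "Cauchy (\<lambda>n. fst (e n))"
  proof (rule CauchyI)
    fix r :: real assume "r > 0"
    then obtain N :: nat where N: "8 / r\<^sup>2 < N"
      using reals_Archimedean2 by blast
    have "norm (fst (e n) - fst (e m)) < r" if "n \<ge> N" "m \<ge> N" for n m
    proof (rule power2_less_imp_less)
      have N0: "N > 0" using N \<open>r > 0\<close> by (cases "N = 0") (auto simp: field_simps)
      have "1 / Suc n \<le> 1 / real N" "1 / Suc m \<le> 1 / real N"
        using that N0 by (auto intro!: divide_left_mono)
      then have "(norm (fst (e n) - fst (e m)))\<^sup>2 \<le> 8 / real N"
        using mid[of n m] by simp
      also have "\<dots> < r\<^sup>2" using N N0 \<open>r > 0\<close> by (simp add: field_simps)
      finally show "(norm (fst (e n) - fst (e m)))\<^sup>2 < r\<^sup>2" .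
    qed (use \<open>r > 0\<close> in simp)
    then show "\<exists>M. \<forall>m\<ge>M. \<forall>n\<ge>M. norm (fst (e m) - fst (e n)) < r" by blast
  qed
  then obtain w0 where w0: "(\<lambda>n. fst (e n)) \<longlonglongrightarrow> w0"
    using Cauchy_convergent convergent_def by blast
  have gh: "(\<lambda>n. g (e n)) \<longlonglongrightarrow> h"
  proof (rule tendsto_sandwich)
    show "(\<lambda>n. h) \<longlonglongrightarrow> h" by simp
    show "(\<lambda>n. h + 1 / Suc n) \<longlonglongrightarrow> h"
      using tendsto_add[OF tendsto_const LIMSEQ_Suc[OF lim_1_over_n], of h] by simp
    show "\<forall>\<^sub>F n in sequentially. h \<le> g (e n)"
      by (intro always_eventually allI h_le eE)
    show "\<forall>\<^sub>F n in sequentially. g (e n) \<le> h + 1 / Suc n"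
      by (intro always_eventually allI less_imp_le ge)
  qed
  define t0 where "t0 = h - (norm w0)\<^sup>2 / 2"
  have "(\<lambda>n. g (e n) - (norm (fst (e n)))\<^sup>2 / 2) \<longlonglongrightarrow> t0"
    unfolding t0_def by (intro tendsto_intros gh w0) simp
  then have "(\<lambda>n. (fst (e n), snd (e n))) \<longlonglongrightarrow> (w0, t0)"
    by (intro tendsto_Pair w0) (simp add: g_def)
  then have mem: "(w0, t0) \<in> E"
    using closed_sequentially[OF assms(1), of e "(w0, t0)"] eE by simp
  have "t0 + (norm w0)\<^sup>2 \<le> t + inner w0 w" if wt: "(w, t) \<in> E" for w t
  proof -
    \<comment> \<open>Compare with a point at parameter \<open>s\<close> of the segment, divide by \<open>s\<close> and let \<open>s\<close> tend to \<open>0\<close>.\<close>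
    have *: "0 \<le> t - t0 + inner w0 (w - w0) + s / 2 * (norm (w - w0))\<^sup>2" if "0 < s" "s < 1" for s
    proof -
      have "(1 - s) *\<^sub>R (w0, t0) + s *\<^sub>R (w, t) \<in> E"
        using convexD[OF assms(2) mem wt, of "1 - s" s] that by simp
      from h_le[OF this]
      have "0 \<le> s * (t - t0 + inner w0 (w - w0) + s / 2 * (norm (w - w0))\<^sup>2)"
        unfolding g_def t0_def power2_norm_eq_inner
        by (simp add: algebra_simps inner_commute power2_eq_square) (simp add: field_simps)
      then show ?thesis using that by (simp add: zero_le_mult_iff)
    qed
    have "((\<lambda>s. t - t0 + inner w0 (w - w0) + s / 2 * (norm (w - w0))\<^sup>2)
             \<longlongrightarrow> t - t0 + inner w0 (w - w0) + 0 / 2 * (norm (w - w0))\<^sup>2) (at_right 0)"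
      by (intro tendsto_intros) auto
    moreover have "\<forall>\<^sub>F s in at_right 0. 0 \<le> t - t0 + inner w0 (w - w0) + s / 2 * (norm (w - w0))\<^sup>2"
      by (rule eventually_at_rightI[of 0 1]) (use * in auto)
    ultimately have "0 \<le> t - t0 + inner w0 (w - w0) + 0 / 2 * (norm (w - w0))\<^sup>2"
      by (rule tendsto_lowerbound) simp
    then show ?thesis by (simp add: inner_diff_right power2_norm_eq_inner)
  qed
  with mem show ?thesis by blast
qed

text \<open>The representing vector minimizes \<open>\<parallel>w\<parallel>\<^sup>2 / 2 - f w\<close>: along the linear graph of \<open>- f\<close> the one-sided
  optimality condition holds for \<open>v\<close> and for \<open>- v\<close>, hence with equality.\<close>
lemma riesz_representation:
  fixes f :: "'b::{real_inner, complete_space} \<Rightarrow> real"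
  assumes "bounded_linear f"
  obtains p where "\<And>v. f v = inner p v"
proof -
  interpret f: bounded_linear f by fact
  obtain K where K: "\<And>w. norm (f w) \<le> norm w * K" using f.bounded by blast
  define E where "E = (\<lambda>w. (w, - f w)) ` UNIV"
  have E: "E = {e. snd e = - f (fst e)}" by (auto simp: E_def image_iff)
  have "closed E"
    unfolding E by (intro closed_Collect_eq continuous_intros f.continuous_on)
  moreover have "convex E"
    unfolding E by (auto simp: convex_def f.add f.scaleR algebra_simps)
  moreover have "E \<noteq> {}" by (auto simp: E_def)
  moreover have "- K\<^sup>2 / 2 \<le> t + (norm w)\<^sup>2 / 2" if "(w, t) \<in> E" for w t
  proof -
    have "f w \<le> norm w * K" using K[of w] by simp
    moreover have "0 \<le> (norm w - K)\<^sup>2" by simp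
    ultimately show ?thesis using that unfolding E by (simp add: power2_diff)
  qed
  ultimately have "\<exists>w0 t0. (w0, t0) \<in> E \<and>
      (\<forall>w t. (w, t) \<in> E \<longrightarrow> t0 + (norm w0)\<^sup>2 \<le> t + inner w0 w)"
    by (rule quadratic_minimizer)
  then obtain w0 t0 where w0: "(w0, t0) \<in> E"
      and min: "\<And>w t. (w, t) \<in> E \<Longrightarrow> t0 + (norm w0)\<^sup>2 \<le> t + inner w0 w"
    by blast
  have le: "f v \<le> inner w0 v" for v
    using min[of "w0 + v" "- f (w0 + v)"] w0
    by (simp add: E f.add inner_add_right power2_norm_eq_inner)
  have "f v = inner w0 v" for v
    using le[of v] le[of "- v"] f.add[of v "- v"] by (simp add: f.zero)
  then show thesis by (rule that)
qed

section \<open>Maximal monotonicity and Minty's theorem\<close>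

text \<open>A point that is monotonically related to the whole graph can be added to it without destroying
  monotonicity. This pointwise form of maximality is the one that proofs use to show that a
  limit point lies on the graph.\<close>
lemma maximally_monotone_iff:
  "maximally_monotone A \<longleftrightarrow>
     monotone_op A \<and> (\<forall>x u. (\<forall>y v. v \<in> A y \<longrightarrow> 0 \<le> inner (x - y) (u - v)) \<longrightarrow> u \<in> A x)"
  (is "_ \<longleftrightarrow> _ \<and> ?R")
proof
  assume max: "maximally_monotone A"
  then have mon: "monotone_op A" by (simp add: maximally_monotone_def)
  have "u \<in> A x" if rel: "\<forall>y v. v \<in> A y \<longrightarrow> 0 \<le> inner (x - y) (u - v)" for x u
  proof -
    define A' where "A' = (\<lambda>y. if y = x then insert u (A y) else A y)"
    have gr: "gr A' = insert (x, u) (gr A)" by (auto simp: gr_def A'_def split: if_splits)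
    have "inner (y - x) (v - u) = inner (x - y) (u - v)" for y v
      by (simp add: inner_diff_left inner_diff_right)
    then have "monotone_op A'"
      using mon rel unfolding monotone_op_def gr by (auto simp: gr_def)
    then have "gr A' = gr A" using max gr by (auto simp: maximally_monotone_def)
    then show ?thesis using gr by (auto simp: gr_def)
  qed
  with mon show "monotone_op A \<and> ?R" by blast
next
  assume R: "monotone_op A \<and> ?R"
  have "gr A' \<subseteq> gr A" if "monotone_op A'" "gr A \<subseteq> gr A'" for A'
  proof (clarsimp simp: gr_def)
    fix x u assume "u \<in> A' x"
    then have "\<forall>y v. v \<in> A y \<longrightarrow> 0 \<le> inner (x - y) (u - v)"
      using that by (auto simp: monotone_op_def gr_def subset_iff)
    then show "u \<in> A x" using R by blast
  qed
  with R show "maximally_monotone A" by (auto simp: maximally_monotone_def)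
qed

lemma monotone_opD:
  "monotone_op A \<Longrightarrow> u \<in> A x \<Longrightarrow> v \<in> A y \<Longrightarrow> 0 \<le> inner (x - y) (u - v)"
  by (auto simp: monotone_op_def gr_def)

text \<open>Let \<open>F (x, u)\<close> be the supremum of \<open>\<langle>x, v\<rangle> + \<langle>y, u\<rangle> - \<langle>y, v\<rangle>\<close> over the points \<open>(y, v)\<close> of the graph
  (the Fitzpatrick function). Monotonicity gives \<open>F (y, v) = \<langle>y, v\<rangle>\<close> on the graph, and maximality
  gives \<open>F (x, u) \<ge> \<langle>x, u\<rangle>\<close> everywhere. Inserting the graph points into the optimality condition of
  the minimizer \<open>(x, u)\<close> of \<open>F + \<parallel>\<cdot>\<parallel>\<^sup>2 / 2\<close> shows that \<open>(- u, - x)\<close> is monotonically related to the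
  graph, hence lies on it, and then that \<open>u = - x\<close>.\<close>
lemma minty_zero:
  fixes A :: "'a::{real_inner, complete_space} \<Rightarrow> 'a set"
  assumes max: "maximally_monotone A"
  shows "\<exists>x. - x \<in> A x"
proof -
  have mon: "monotone_op A" and rel: "\<And>x u. (\<And>y v. v \<in> A y \<Longrightarrow> 0 \<le> inner (x - y) (u - v)) \<Longrightarrow> u \<in> A x"
    using max by (auto simp: maximally_monotone_iff)
  \<comment> \<open>The epigraph of the Fitzpatrick function.\<close>
  define E :: "(('a \<times> 'a) \<times> real) set" where
    "E = {e. \<forall>y v. v \<in> A y \<longrightarrow> inner (fst (fst e)) v + inner y (snd (fst e)) - inner y v \<le> snd e}"
  have closed: "closed E"
    unfolding E_def by (intro closed_Collect_all closed_Collect_imp closed_Collect_le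
        open_Collect_const continuous_intros)
  have convex: "convex E"
  proof (rule convexI)
    fix e e' :: "('a \<times> 'a) \<times> real" and s r :: real
    assume e: "e \<in> E" and e': "e' \<in> E" and sr: "0 \<le> s" "0 \<le> r" "s + r = 1"
    show "s *\<^sub>R e + r *\<^sub>R e' \<in> E"
      unfolding E_def
    proof (intro CollectI allI impI)
      fix y v assume v: "v \<in> A y"
      let ?q = "\<lambda>e :: ('a \<times> 'a) \<times> real. inner (fst (fst e)) v + inner y (snd (fst e)) - inner y v"
      have "s * ?q e + r * ?q e' \<le> s * snd e + r * snd e'"
        using e e' v sr unfolding E_def by (intro add_mono mult_left_mono) auto
      moreover have "s * ?q e + r * ?q e' = ?q (s *\<^sub>R e + r *\<^sub>R e')"
        using arg_cong[OF sr(3), of "\<lambda>k. k * inner y v"]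
        by (simp add: inner_add_left inner_add_right algebra_simps)
      ultimately show "?q (s *\<^sub>R e + r *\<^sub>R e') \<le> snd (s *\<^sub>R e + r *\<^sub>R e')" by simp
    qed
  qed
  have graph: "((y, v), inner y v) \<in> E" if "v \<in> A y" for y v
  proof (clarsimp simp: E_def)
    fix y' v' assume "v' \<in> A y'"
    from monotone_opD[OF mon that this]
    show "inner y v' + inner y' v - inner y' v' \<le> inner y v"
      by (simp add: inner_diff_left inner_diff_right)
  qed
  have above: "inner x u \<le> t" if "((x, u), t) \<in> E" for x u t
  proof (cases "u \<in> A x")
    case True
    then show ?thesis using that by (force simp: E_def)
  next
    case False
    then obtain y v where "v \<in> A y" "inner (x - y) (u - v) < 0"
      using rel not_le by blast
    then show ?thesis using that
      by (force simp: E_def inner_diff_left inner_diff_right)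
  qed
  \<comment> \<open>An operator with empty graph is not maximal: every point would be related to its graph.\<close>
  have "\<exists>y v. v \<in> A y"
    using rel[where x=0 and u=0] by blast
  with graph have nonempty: "E \<noteq> {}" by blast
  have bound: "0 \<le> t + (norm w)\<^sup>2 / 2" if "(w, t) \<in> E" for w t
  proof -
    obtain x u where w: "w = (x, u)" by force
    have "0 \<le> (norm (x + u))\<^sup>2" by simp
    also have "\<dots> = (norm w)\<^sup>2 + 2 * inner x u"
      by (simp add: w norm_Pair power2_norm_eq_inner inner_add_left inner_add_right inner_commute)
    finally show ?thesis using above[of x u t] that w by simp
  qed
  obtain w0 t0 where w0: "(w0, t0) \<in> E"
      and min: "\<And>w t. (w, t) \<in> E \<Longrightarrow> t0 + (norm w0)\<^sup>2 \<le> t + inner w0 w"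
    using quadratic_minimizer[OF closed convex nonempty bound] by blast
  obtain x u where xu: "w0 = (x, u)" by force
  have key: "(norm (x + u))\<^sup>2 \<le> inner (- u - y) (- x - v)" if "v \<in> A y" for y v
    using min[OF graph[OF that]] above[of x u t0] w0
    by (simp add: xu norm_Pair power2_norm_eq_inner inner_add_left inner_add_right
        inner_diff_left inner_diff_right inner_commute)
  have "- x \<in> A (- u)"
    by (rule rel) (use key in \<open>meson order_trans zero_le_power2\<close>)
  moreover from key[OF this] have "u = - x"
    by (simp add: add_eq_0_iff)
  ultimately show ?thesis by auto
qed

text \<open>Minty's surjectivity theorem: every \<open>w\<close> lies in the range of \<open>Id + A\<close>. Translating the values of
  \<open>A\<close> by \<open>w\<close> reduces it to the case \<open>w = 0\<close>.\<close>
theorem minty: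
  fixes A :: "'a::{real_inner, complete_space} \<Rightarrow> 'a set"
  assumes "maximally_monotone A"
  shows "\<exists>x. w - x \<in> A x"
proof -
  have "maximally_monotone (\<lambda>x. {u. u + w \<in> A x})"
    unfolding maximally_monotone_iff
  proof (intro conjI allI impI)
    show "monotone_op (\<lambda>x. {u. u + w \<in> A x})"
      using assms unfolding monotone_op_def gr_def maximally_monotone_def
      by (clarsimp) (metis add_diff_cancel_right)
    fix x u assume *: "\<forall>y v. v \<in> {u. u + w \<in> A y} \<longrightarrow> 0 \<le> inner (x - y) (u - v)"
    have "0 \<le> inner (x - y) (u + w - v)" if "v \<in> A y" for y v
      using *[rule_format, of "v - w" y] that by (simp add: algebra_simps)
    then show "u \<in> {u. u + w \<in> A x}"
      using assms by (auto simp: maximally_monotone_iff)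
  qed
  from minty_zero[OF this] show ?thesis by (simp add: algebra_simps)
qed

section \<open>Weak limits along filters\<close>

text \<open>Weak convergence along an arbitrary filter. Subfilters of \<^term>\<open>sequentially\<close> play the part of
  subsequences; in this form compactness is a direct consequence of Tychonoff's theorem.\<close>
definition weak_limit :: "(nat \<Rightarrow> 'a::real_inner) \<Rightarrow> 'a \<Rightarrow> nat filter \<Rightarrow> bool" where
  "weak_limit x l F \<longleftrightarrow> (\<forall>v. ((\<lambda>n. inner (x n) v) \<longlongrightarrow> inner l v) F)"

lemma weak_limit_filter_mono: "weak_limit x p F \<Longrightarrow> G \<le> F \<Longrightarrow> weak_limit x p G"
  unfolding weak_limit_def using tendsto_mono by blast

lemma weak_limit_perturb:
  assumes "weak_limit x p F" and "((\<lambda>n. y n - x n) \<longlongrightarrow> 0) F"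
  shows "weak_limit y p F"
  unfolding weak_limit_def
proof
  fix v
  have "((\<lambda>n. inner (x n) v + inner (y n - x n) v) \<longlongrightarrow> inner p v + inner 0 v) F"
    by (intro tendsto_intros assms(2) assms(1)[unfolded weak_limit_def, rule_format])
  then show "((\<lambda>n. inner (y n) v) \<longlongrightarrow> inner p v) F"
    by (simp add: inner_diff_left)
qed

text \<open>The functionals \<open>\<langle>x n, \<cdot>\<rangle>\<close> lie in a product of compact intervals, so they have a pointwise cluster
  point along \<open>F\<close>. It is a bounded linear functional, which Riesz turns into a vector.\<close>
lemma weak_compactness:
  fixes x :: "nat \<Rightarrow> 'a::{real_inner, complete_space}"
  assumes bd: "\<forall>\<^sub>F n in F. norm (x n) \<le> M" and F: "F \<noteq> bot"
  shows "\<exists>G p. G \<le> F \<and> G \<noteq> bot \<and> weak_limit x p G"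
proof -
  define \<Phi> where "\<Phi> = (\<lambda>n v. inner (x n) v)"
  define K :: "('a \<Rightarrow> real) set" where "K = PiE UNIV (\<lambda>v. {- (M * norm v)..M * norm v})"
  have "compactin (product_topology (\<lambda>i::'a. euclidean) UNIV) K"
    unfolding K_def by (subst compactin_PiE) simp
  then have "compact K"
    by (simp add: euclidean_product_topology)
  moreover have "filtermap \<Phi> F \<noteq> bot" using F by (simp add: filtermap_bot_iff)
  moreover have "eventually (\<lambda>f. f \<in> K) (filtermap \<Phi> F)"
    unfolding eventually_filtermap using bd
  proof eventually_elim
    case (elim n)
    have "\<bar>inner (x n) v\<bar> \<le> M * norm v" for v
      using Cauchy_Schwarz_ineq2[of "x n" v] mult_right_mono[OF elim norm_ge_zero[of v]] by linarith
    then have "inner (x n) v \<le> M * norm v" "- (M * norm v) \<le> inner (x n) v" for v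
      by (simp_all add: abs_le_iff minus_le_iff)
    then show "\<Phi> n \<in> K" by (auto simp: K_def \<Phi>_def)
  qed
  ultimately obtain f where f: "f \<in> K" "inf (nhds f) (filtermap \<Phi> F) \<noteq> bot"
    by (auto simp: compact_filter)
  define G where "G = inf F (filtercomap \<Phi> (nhds f))"
  have "G \<noteq> bot"
  proof
    assume "G = bot"
    then obtain P R where P: "eventually P F" and R: "eventually R (nhds f)"
        and PR: "\<And>n. P n \<Longrightarrow> \<not> R (\<Phi> n)"
      by (auto simp: G_def trivial_limit_def eventually_inf eventually_filtercomap)
    from P have "eventually (\<lambda>g. \<not> R g) (filtermap \<Phi> F)"
      unfolding eventually_filtermap by (rule eventually_mono) (rule PR)
    with R have "inf (nhds f) (filtermap \<Phi> F) = bot"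
      by (auto simp: trivial_limit_def eventually_inf)
    with f(2) show False by simp
  qed
  moreover have "G \<le> F" by (simp add: G_def)
  moreover have conv: "((\<lambda>n. inner (x n) v) \<longlongrightarrow> f v) G" for v
  proof -
    have "((\<lambda>n. \<Phi> n v) \<longlongrightarrow> f v) G"
    proof (rule topological_tendstoI)
      fix S assume "open S" "f v \<in> S"
      have "open ((\<lambda>g :: 'a \<Rightarrow> real. g v) -` S)"
        by (rule open_vimage[OF \<open>open S\<close> continuous_on_product_coordinates])
      then have "eventually (\<lambda>g. g v \<in> S) (nhds f)"
        using \<open>f v \<in> S\<close> by (auto simp: eventually_nhds)
      then have "eventually (\<lambda>n. \<Phi> n v \<in> S) (filtercomap \<Phi> (nhds f))"
        by (rule eventually_filtercomapI)
      then show "eventually (\<lambda>n. \<Phi> n v \<in> S) G"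
        by (rule filter_leD[rotated]) (simp add: G_def)
    qed
    then show ?thesis by (simp add: \<Phi>_def)
  qed
  have "bounded_linear f"
  proof (rule bounded_linear_intro)
    fix u v :: 'a and r :: real
    have "((\<lambda>n. inner (x n) (u + v)) \<longlongrightarrow> f u + f v) G"
      unfolding inner_add_right by (intro tendsto_add conv)
    then show "f (u + v) = f u + f v"
      using tendsto_unique[OF \<open>G \<noteq> bot\<close> conv] by blast
    have "((\<lambda>n. inner (x n) (r *\<^sub>R v)) \<longlongrightarrow> r * f v) G"
      unfolding inner_scaleR_right by (intro tendsto_mult_left conv)
    then show "f (r *\<^sub>R v) = r *\<^sub>R f v"
      using tendsto_unique[OF \<open>G \<noteq> bot\<close> conv] by (metis real_scaleR_def)
    have "f v \<in> {- (M * norm v)..M * norm v}" using f(1) unfolding K_def by blast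
    then show "norm (f v) \<le> norm v * M" by (simp add: mult.commute abs_le_iff)
  qed
  then obtain p where "\<And>v. f v = inner p v" by (rule riesz_representation) blast
  with conv have "weak_limit x p G" by (simp add: weak_limit_def)
  ultimately show ?thesis by blast
qed

text \<open>If weak convergence failed against some \<open>v\<close>, the indices that stay away from the limit would
  define a subfilter, and compactness would give a further subfilter with a weak limit that
  cannot be \<open>p\<close>.\<close>
lemma weakly_converges_of_unique_weak_limit:
  fixes x :: "nat \<Rightarrow> 'a::{real_inner, complete_space}"
  assumes bd: "\<forall>\<^sub>F n in sequentially. norm (x n) \<le> M"
    and unique: "\<And>G q. G \<le> sequentially \<Longrightarrow> G \<noteq> bot \<Longrightarrow> weak_limit x q G \<Longrightarrow> q = p"
  shows "weakly_converges x p"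
  unfolding weakly_converges_def
proof (rule allI, rule ccontr)
  fix v assume "\<not> (\<lambda>n. inner (x n) v) \<longlonglongrightarrow> inner p v"
  then obtain e where e: "e > 0" "\<not> (\<forall>\<^sub>F n in sequentially. dist (inner (x n) v) (inner p v) < e)"
    by (auto simp: tendsto_iff)
  define F where "F = inf sequentially (principal {n. \<not> dist (inner (x n) v) (inner p v) < e})"
  have Fle: "F \<le> sequentially" by (simp add: F_def)
  have "F \<noteq> bot"
    using e(2) by (simp add: F_def trivial_limit_def eventually_inf_principal)
  then obtain G q where G: "G \<le> F" "G \<noteq> bot" "weak_limit x q G"
    using weak_compactness[OF filter_leD[OF Fle bd]] by blast
  have "q = p" using unique G Fle by (meson order_trans)
  then have "\<forall>\<^sub>F n in G. dist (inner (x n) v) (inner p v) < e"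
    using G(3) e(1) by (auto simp: weak_limit_def tendsto_iff)
  moreover have "\<forall>\<^sub>F n in G. \<not> dist (inner (x n) v) (inner p v) < e"
    using G(1) by (rule filter_leD) (simp add: F_def eventually_inf_principal)
  ultimately have "\<forall>\<^sub>F n in G. False" by eventually_elim blast
  with G(2) show False by (simp add: trivial_limit_def)
qed

section \<open>Resolvents\<close>

lemma op_inverse_id_plus: "op_inverse (op_plus op_id A) w = {p. w - p \<in> A p}"
  for w :: "'a::real_inner"
  by (auto simp: op_inverse_def op_plus_def op_id_def intro: exI[of _ "w - _"])

text \<open>Minty's theorem makes the value of \<open>(Id + A)\<^sup>-\<^sup>1\<close> nonempty and monotonicity makes it a singleton, so
  the resolvent has its intended meaning everywhere.\<close>
lemma resolvent_eq_iff:
  fixes A :: "'a::{real_inner, complete_space} \<Rightarrow> 'a set"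
  assumes "maximally_monotone A"
  shows "resolvent A w = p \<longleftrightarrow> w - p \<in> A p"
proof -
  have mon: "monotone_op A" using assms by (simp add: maximally_monotone_iff)
  have unique: "p = q" if "w - p \<in> A p" "w - q \<in> A q" for p q
  proof -
    have "0 \<le> inner (p - q) ((w - p) - (w - q))" using monotone_opD[OF mon that] .
    also have "\<dots> = - (norm (p - q))\<^sup>2"
      by (simp add: power2_norm_eq_inner inner_diff_left inner_diff_right inner_commute)
    finally show ?thesis by simp
  qed
  obtain q where q: "w - q \<in> A q" using minty[OF assms] by blast
  then have "op_inverse (op_plus op_id A) w = {q}"
    using unique by (auto simp: op_inverse_id_plus)
  then have "resolvent A w = q" by (simp add: resolvent_def)
  with q unique show ?thesis by blast
qed

lemma resolvent_mem:
  fixes A :: "'a::{real_inner, complete_space} \<Rightarrow> 'a set"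
  assumes "maximally_monotone A"
  shows "w - resolvent A w \<in> A (resolvent A w)"
  using resolvent_eq_iff[OF assms] by blast

lemma mem_op_scale_iff:
  assumes "\<gamma> \<noteq> 0"
  shows "u \<in> op_scale \<gamma> A x \<longleftrightarrow> (1 / \<gamma>) *\<^sub>R u \<in> A x"
  using assms by (auto simp: op_scale_def intro: exI[of _ "(1 / \<gamma>) *\<^sub>R u"])

lemma maximally_monotone_op_scale:
  assumes A: "maximally_monotone A" and "\<gamma> > 0"
  shows "maximally_monotone (op_scale \<gamma> A)"
  unfolding maximally_monotone_iff
proof (intro conjI allI impI)
  show "monotone_op (op_scale \<gamma> A)"
    unfolding monotone_op_def
  proof (clarsimp simp: gr_def op_scale_def simp flip: scaleR_diff_right)
    fix x y u v assume "u \<in> A x" "v \<in> A y"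
    then have "0 \<le> inner (x - y) (u - v)"
      using A monotone_opD by (auto simp: maximally_monotone_iff)
    then show "0 \<le> \<gamma> * inner (x - y) (u - v)" using \<open>\<gamma> > 0\<close> by simp
  qed
  fix x u assume *: "\<forall>y v. v \<in> op_scale \<gamma> A y \<longrightarrow> 0 \<le> inner (x - y) (u - v)"
  have "0 \<le> inner (x - y) ((1 / \<gamma>) *\<^sub>R u - v)" if "v \<in> A y" for y v
  proof -
    have "0 \<le> inner (x - y) (u - \<gamma> *\<^sub>R v)"
      using * that by (auto simp: op_scale_def)
    also have "\<dots> = \<gamma> * inner (x - y) ((1 / \<gamma>) *\<^sub>R u - v)"
      using \<open>\<gamma> > 0\<close> by (simp add: inner_diff_right algebra_simps)
    finally show ?thesis using \<open>\<gamma> > 0\<close> by (simp add: zero_le_mult_iff)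
  qed
  then have "(1 / \<gamma>) *\<^sub>R u \<in> A x" using A unfolding maximally_monotone_iff by blast
  then show "u \<in> op_scale \<gamma> A x" using \<open>\<gamma> > 0\<close> by (simp add: mem_op_scale_iff)
qed

lemma resolvent_firmly_nonexpansive:
  fixes A :: "'a::{real_inner, complete_space} \<Rightarrow> 'a set"
  assumes "maximally_monotone A"
  shows "(norm (resolvent A v - resolvent A w))\<^sup>2 \<le> inner (resolvent A v - resolvent A w) (v - w)"
proof -
  have "0 \<le> inner (resolvent A v - resolvent A w) ((v - resolvent A v) - (w - resolvent A w))"
    using assms by (intro monotone_opD[of A] resolvent_mem) (simp add: maximally_monotone_iff)
  then show ?thesis
    by (simp add: power2_norm_eq_inner inner_diff_left inner_diff_right inner_commute)
qed

lemma resolvent_nonexpansive: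
  fixes A :: "'a::{real_inner, complete_space} \<Rightarrow> 'a set"
  assumes "maximally_monotone A"
  shows "norm (resolvent A v - resolvent A w) \<le> norm (v - w)"
proof -
  let ?d = "norm (resolvent A v - resolvent A w)"
  have "?d * ?d \<le> ?d * norm (v - w)"
    using resolvent_firmly_nonexpansive[OF assms, of v w]
      norm_cauchy_schwarz[of "resolvent A v - resolvent A w" "v - w"]
    by (simp add: power2_eq_square)
  then show ?thesis
    by (cases "?d = 0") (auto simp: mult_le_cancel_left)
qed

lemma reflected_resolvent_nonexpansive:
  fixes A :: "'a::{real_inner, complete_space} \<Rightarrow> 'a set"
  assumes "maximally_monotone A"
  shows "norm (reflected_resolvent A v - reflected_resolvent A w) \<le> norm (v - w)"
proof (rule power2_le_imp_le)
  let ?D = "resolvent A v - resolvent A w"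
  have "reflected_resolvent A v - reflected_resolvent A w = 2 *\<^sub>R ?D - (v - w)"
    by (simp add: reflected_resolvent_def algebra_simps)
  also have "(norm \<dots>)\<^sup>2 = 4 * ((norm ?D)\<^sup>2 - inner ?D (v - w)) + (norm (v - w))\<^sup>2"
    unfolding power2_norm_eq_inner inner_diff_left[of "2 *\<^sub>R ?D"] inner_diff_right[of _ "2 *\<^sub>R ?D"]
    by (simp only: inner_scaleR_left inner_scaleR_right inner_commute[of "v - w" ?D])
      (simp add: algebra_simps)
  also have "\<dots> \<le> (norm (v - w))\<^sup>2"
    using resolvent_firmly_nonexpansive[OF assms, of v w] by simp
  finally show "(norm (reflected_resolvent A v - reflected_resolvent A w))\<^sup>2 \<le> (norm (v - w))\<^sup>2" .
qed simp

section \<open>Weak convergence to fixed points of nonexpansive maps\<close>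

text \<open>Expanding \<open>\<parallel>x n - T p\<parallel>\<^sup>2\<close> around \<open>p\<close> produces the extra term \<open>\<parallel>p - T p\<parallel>\<^sup>2\<close> and an inner product that
  vanishes in the weak limit, whereas nonexpansiveness bounds \<open>\<parallel>x n - T p\<parallel>\<close> by \<open>\<parallel>x n - p\<parallel>\<close> up to the
  vanishing residual.\<close>
lemma demiclosedness:
  fixes T :: "'a::real_inner \<Rightarrow> 'a"
  assumes nonexp: "\<And>v w. norm (T v - T w) \<le> norm (v - w)"
    and G: "G \<noteq> bot" and bd: "\<forall>\<^sub>F n in G. norm (x n) \<le> M"
    and weak: "weak_limit x p G"
    and residual: "((\<lambda>n. norm (x n - T (x n))) \<longlongrightarrow> 0) G"
  shows "T p = p"
proof -
  let ?e = "\<lambda>n. norm (x n - T (x n))"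
  let ?r = "\<lambda>n. ?e n * (?e n + 2 * (M + norm p)) - 2 * (inner (x n) (p - T p) - inner p (p - T p))"
  have "(?r \<longlongrightarrow> 0 * (0 + 2 * (M + norm p)) - 2 * (inner p (p - T p) - inner p (p - T p))) G"
    by (intro tendsto_intros residual weak[unfolded weak_limit_def, rule_format])
  then have "(?r \<longlongrightarrow> 0) G" by simp
  moreover have "\<forall>\<^sub>F n in G. (norm (p - T p))\<^sup>2 \<le> ?r n"
    using bd
  proof eventually_elim
    case (elim n)
    have "norm (x n - T p) \<le> ?e n + norm (x n - p)"
      using norm_triangle_ineq[of "x n - T (x n)" "T (x n) - T p"] nonexp[of "x n" p] by simp
    then have "(norm (x n - T p))\<^sup>2 \<le> (?e n + norm (x n - p))\<^sup>2"
      by (rule power_mono) simp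
    also have "\<dots> = (norm (x n - p))\<^sup>2 + ?e n * (?e n + 2 * norm (x n - p))"
      by (simp add: power2_eq_square algebra_simps)
    also have "?e n * (?e n + 2 * norm (x n - p)) \<le> ?e n * (?e n + 2 * (M + norm p))"
      using norm_triangle_ineq4[of "x n" p] elim by (intro mult_left_mono) auto
    finally have "(norm (x n - T p))\<^sup>2 \<le> (norm (x n - p))\<^sup>2 + ?e n * (?e n + 2 * (M + norm p))"
      by simp
    moreover have "(norm (x n - T p))\<^sup>2
        = (norm (x n - p))\<^sup>2 + (norm (p - T p))\<^sup>2 + 2 * (inner (x n) (p - T p) - inner p (p - T p))"
      by (simp add: power2_norm_eq_inner inner_diff_left inner_diff_right inner_commute)
    ultimately show ?case by linarith
  qed
  ultimately have "(norm (p - T p))\<^sup>2 \<le> 0"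
    using G by (intro tendsto_lowerbound)
  then show ?thesis by simp
qed

text \<open>Opial's lemma. For two points \<open>p\<close>, \<open>q\<close> of \<open>C\<close> the sequence \<open>\<langle>x n, q - p\<rangle>\<close> is a combination of the two
  convergent squared distances, so it has the same limit along every subfilter; if both points
  are weak limits this forces \<open>p = q\<close>.\<close>
lemma opial:
  fixes x :: "nat \<Rightarrow> 'a::{real_inner, complete_space}"
  assumes "C \<noteq> {}"
    and conv: "\<And>p. p \<in> C \<Longrightarrow> convergent (\<lambda>n. (norm (x n - p))\<^sup>2)"
    and limits: "\<And>G q. G \<le> sequentially \<Longrightarrow> G \<noteq> bot \<Longrightarrow> weak_limit x q G \<Longrightarrow> q \<in> C"
    and bd: "\<And>n. norm (x n) \<le> M"
  shows "\<exists>p\<in>C. weakly_converges x p"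
proof -
  have bd': "\<forall>\<^sub>F n in sequentially. norm (x n) \<le> M" using bd by simp
  obtain G p where G: "G \<le> sequentially" "G \<noteq> bot" "weak_limit x p G"
    using weak_compactness[OF bd' sequentially_bot] by blast
  then have p: "p \<in> C" by (rule limits)
  have "weakly_converges x p"
  proof (rule weakly_converges_of_unique_weak_limit[OF bd'])
    fix H q assume H: "H \<le> sequentially" "H \<noteq> bot" "weak_limit x q H"
    then have q: "q \<in> C" by (rule limits)
    obtain lp lq where "(\<lambda>n. (norm (x n - p))\<^sup>2) \<longlonglongrightarrow> lp" "(\<lambda>n. (norm (x n - q))\<^sup>2) \<longlonglongrightarrow> lq"
      using conv[OF p] conv[OF q] unfolding convergent_def by blast
    then have l: "(\<lambda>n. ((norm (x n - p))\<^sup>2 - (norm (x n - q))\<^sup>2 - (norm p)\<^sup>2 + (norm q)\<^sup>2) / 2)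
        \<longlonglongrightarrow> (lp - lq - (norm p)\<^sup>2 + (norm q)\<^sup>2) / 2" (is "_ \<longlonglongrightarrow> ?l")
      by (intro tendsto_intros) auto
    have eq: "((norm (x n - p))\<^sup>2 - (norm (x n - q))\<^sup>2 - (norm p)\<^sup>2 + (norm q)\<^sup>2) / 2 = inner (x n) (q - p)"
      for n by (simp add: power2_norm_eq_inner inner_diff_left inner_diff_right inner_commute)
    have "inner r (q - p) = ?l" if "K \<le> sequentially" "K \<noteq> bot" "weak_limit x r K" for K r
      using that tendsto_mono[OF that(1) l] unfolding eq weak_limit_def
      by (meson tendsto_unique)
    then have "inner q (q - p) = inner p (q - p)" using G H by metis
    then have "inner (q - p) (q - p) = 0" by (simp add: inner_diff_left)
    then show "q = p" by simp
  qed
  with p show ?thesis by blast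
qed

section \<open>The inertial Krasnoselskii-Mann iteration\<close>

lemma contraction_residual_tendsto_zero:
  fixes u :: "nat \<Rightarrow> real"
  assumes a: "0 \<le> a" "a < 1"
    and e: "(\<lambda>n. u (Suc n) - a * u n) \<longlonglongrightarrow> 0"
  shows "u \<longlonglongrightarrow> 0"
proof (rule LIMSEQ_I)
  fix r :: real assume "r > 0"
  then have "r / 2 * (1 - a) > 0" using a by simp
  from LIMSEQ_D[OF e this] obtain N where
    N: "\<And>n. n \<ge> N \<Longrightarrow> \<bar>u (Suc n) - a * u n\<bar> < r / 2 * (1 - a)" by auto
  have bound: "\<bar>u (N + k)\<bar> \<le> a ^ k * \<bar>u N\<bar> + r / 2" for k
  proof (induction k)
    case 0
    then show ?case using \<open>r > 0\<close> by simp
  next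
    case (Suc k)
    have "\<bar>u (Suc (N + k))\<bar> \<le> a * \<bar>u (N + k)\<bar> + r / 2 * (1 - a)"
      using N[of "N + k"] a abs_mult[of a "u (N + k)"] by (simp add: abs_if split: if_splits)
    also have "\<dots> \<le> a * (a ^ k * \<bar>u N\<bar> + r / 2) + r / 2 * (1 - a)"
      using mult_left_mono[OF Suc a(1)] by simp
    finally show ?case by (simp add: field_simps)
  qed
  have "(\<lambda>k. a ^ k * \<bar>u N\<bar>) \<longlonglongrightarrow> 0 * \<bar>u N\<bar>"
    using a by (intro tendsto_intros LIMSEQ_power_zero) simp
  then obtain K where K: "\<And>k. k \<ge> K \<Longrightarrow> \<bar>a ^ k * \<bar>u N\<bar>\<bar> < r / 2"
    using \<open>r > 0\<close> LIMSEQ_D[of "\<lambda>k. a ^ k * \<bar>u N\<bar>" 0 "r / 2"] by auto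
  have "norm (u n - 0) < r" if "n \<ge> N + K" for n
  proof -
    have "n - N \<ge> K" "N + (n - N) = n" using that by auto
    then have "\<bar>u n\<bar> \<le> a ^ (n - N) * \<bar>u N\<bar> + r / 2" "\<bar>a ^ (n - N) * \<bar>u N\<bar>\<bar> < r / 2"
      using bound[of "n - N"] K[of "n - N"] by simp_all
    then show ?thesis unfolding real_norm_def by linarith
  qed
  then show "\<exists>n0. \<forall>n\<ge>n0. norm (u n - 0) < r" by blast
qed

text \<open>The hypothesis says that \<open>\<Psi> n = \<phi> (n + 1) - a n * \<phi> n + g n * d n\<close> decreases by at least
  \<open>\<sigma> * d (n + 1)\<close>. Although \<open>\<Psi>\<close> may be negative, \<open>\<phi> (n + 1) \<le> \<Psi> 0 + \<alpha> * \<phi> n\<close> with \<open>\<alpha> < 1\<close> bounds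
  \<open>\<phi>\<close> and hence \<open>\<Psi>\<close> from below, so \<open>d\<close> is summable and \<open>\<Psi>\<close> converges. As \<open>a\<close> is monotone it
  converges as well, and \<open>\<phi> (n + 1) - a' * \<phi> n\<close> has a limit for \<open>a' = lim a < 1\<close>; this contraction
  forces \<open>\<phi>\<close> itself to converge.\<close>
lemma inertial_lyapunov_convergence:
  fixes \<phi> d a g :: "nat \<Rightarrow> real"
  assumes phi0: "\<And>n. 0 \<le> \<phi> n" and d0: "\<And>n. 0 \<le> d n" and inc: "incseq a"
    and a: "\<And>n. 0 \<le> a n" "\<And>n. a n \<le> \<alpha>" and "\<alpha> < 1"
    and g: "\<And>n. 0 \<le> g n" "\<And>n. g n \<le> K" and "\<sigma> > 0"
    and descent: "\<And>n. \<phi> (Suc (Suc n)) - a (Suc n) * \<phi> (Suc n) + g (Suc n) * d (Suc n) + \<sigma> * d (Suc n)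
                      \<le> \<phi> (Suc n) - a n * \<phi> n + g n * d n"
  shows "summable d" "convergent \<phi>"
proof -
  define \<Psi> where "\<Psi> n = \<phi> (Suc n) - a n * \<phi> n + g n * d n" for n
  have step: "\<Psi> (Suc n) + \<sigma> * d (Suc n) \<le> \<Psi> n" for n
    using descent by (simp add: \<Psi>_def)
  have "\<Psi> (Suc n) \<le> \<Psi> n" for n
    using step[of n] d0[of "Suc n"] \<open>\<sigma> > 0\<close> mult_nonneg_nonneg[of \<sigma> "d (Suc n)"] by linarith
  then have dec: "decseq \<Psi>" by (rule decseq_SucI)
  have alpha0: "0 \<le> \<alpha>" using a order_trans by blast
  \<comment> \<open>The maximum of the start value and the fixed point of \<open>t \<mapsto> \<alpha> * t + \<bar>\<Psi> 0\<bar>\<close>.\<close>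
  define M where "M = max (\<phi> 0) (\<bar>\<Psi> 0\<bar> / (1 - \<alpha>))"
  have lower: "\<phi> (Suc n) \<le> \<Psi> n + \<alpha> * \<phi> n" for n
    using mult_right_mono[OF a(2) phi0, of n n] mult_nonneg_nonneg[OF g(1) d0, of n n]
    unfolding \<Psi>_def by linarith
  have phi_le: "\<phi> n \<le> M" for n
  proof (induction n)
    case 0
    show ?case by (simp add: M_def)
  next
    case (Suc n)
    have "\<bar>\<Psi> 0\<bar> / (1 - \<alpha>) \<le> M" by (simp add: M_def)
    then have "\<bar>\<Psi> 0\<bar> \<le> M * (1 - \<alpha>)" using \<open>\<alpha> < 1\<close> by (simp add: pos_divide_le_eq)
    moreover have "\<Psi> n \<le> \<Psi> 0" using dec by (simp add: decseq_def)
    moreover have "\<alpha> * \<phi> n \<le> \<alpha> * M" using Suc alpha0 by (rule mult_left_mono)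
    ultimately show ?case using lower[of n] by (simp add: algebra_simps)
  qed
  have Psi_lower: "- (\<alpha> * M) \<le> \<Psi> n" for n
    using lower[of n] phi0[of "Suc n"] mult_left_mono[OF phi_le alpha0, of n] by linarith
  have sum_le: "\<sigma> * (\<Sum>k<n. d (Suc k)) \<le> \<Psi> 0 - \<Psi> n" for n
  proof (induction n)
    case (Suc n)
    then show ?case using step[of n] by (simp add: distrib_left)
  qed simp
  have "\<sigma> * (\<Sum>k<n. d (Suc k)) \<le> \<Psi> 0 + \<alpha> * M" for n
    using sum_le[of n] Psi_lower[of n] by linarith
  then have "(\<Sum>k<n. d (Suc k)) \<le> (\<Psi> 0 + \<alpha> * M) / \<sigma>" for n
    using \<open>\<sigma> > 0\<close> by (simp add: pos_le_divide_eq mult.commute)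
  then have "summable (\<lambda>k. d (Suc k))"
    by (intro summableI_nonneg_bounded d0)
  then show "summable d" by (simp add: summable_Suc_iff)
  then have dlim: "d \<longlonglongrightarrow> 0" by (rule summable_LIMSEQ_zero)
  obtain L where L: "\<Psi> \<longlonglongrightarrow> L"
    using decseq_convergent[OF dec, of "- (\<alpha> * M)"] Psi_lower by blast
  obtain a' where a': "a \<longlonglongrightarrow> a'" "\<And>n. a n \<le> a'"
    using incseq_convergent[OF inc, of \<alpha>] a(2) by blast
  have a'01: "0 \<le> a'" "a' < 1"
    using a'(2)[of 0] a(1)[of 0] LIMSEQ_le_const2[OF a'(1), of \<alpha>] a(2) \<open>\<alpha> < 1\<close> by auto
  have gd: "(\<lambda>n. g n * d n) \<longlonglongrightarrow> 0"
  proof (rule tendsto_sandwich)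
    show "\<forall>\<^sub>F n in sequentially. g n * d n \<le> K * d n"
      by (intro always_eventually allI mult_right_mono g d0)
    show "\<forall>\<^sub>F n in sequentially. 0 \<le> g n * d n"
      by (intro always_eventually allI mult_nonneg_nonneg g d0)
    show "(\<lambda>n. K * d n) \<longlonglongrightarrow> 0" using tendsto_mult_right_zero[OF dlim] .
  qed simp
  have aphi: "(\<lambda>n. (a' - a n) * \<phi> n) \<longlonglongrightarrow> 0"
  proof (rule tendsto_sandwich)
    show "\<forall>\<^sub>F n in sequentially. (a' - a n) * \<phi> n \<le> (a' - a n) * M"
      using a'(2) by (intro always_eventually allI mult_left_mono phi_le) simp
    show "\<forall>\<^sub>F n in sequentially. 0 \<le> (a' - a n) * \<phi> n"
      using a'(2) by (intro always_eventually allI mult_nonneg_nonneg phi0) simp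
    have "(\<lambda>n. (a' - a n) * M) \<longlonglongrightarrow> (a' - a') * M" by (intro tendsto_intros a')
    then show "(\<lambda>n. (a' - a n) * M) \<longlonglongrightarrow> 0" by simp
  qed simp
  define l where "l = L / (1 - a')"
  have "(\<lambda>n. \<Psi> n - g n * d n - (a' - a n) * \<phi> n - L) \<longlonglongrightarrow> L - 0 - 0 - L"
    by (intro tendsto_diff L gd aphi tendsto_const)
  moreover have "\<Psi> n - g n * d n - (a' - a n) * \<phi> n - L = (\<phi> (Suc n) - l) - a' * (\<phi> n - l)" for n
  proof -
    have "l * (1 - a') = L" using a'01 by (simp add: l_def)
    then show ?thesis by (simp add: \<Psi>_def algebra_simps)
  qed
  ultimately have "(\<lambda>n. (\<phi> (Suc n) - l) - a' * (\<phi> n - l)) \<longlonglongrightarrow> 0"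
    by simp
  then have "(\<lambda>n. \<phi> n - l) \<longlonglongrightarrow> 0"
    by (rule contraction_residual_tendsto_zero[OF a'01])
  then show "convergent \<phi>" by (auto simp: convergent_def LIM_zero_iff)
qed

text \<open>One step from \<open>xm\<close> and \<open>xc\<close> to \<open>xn\<close>. The relaxed step loses \<open>\<mu> * (1 - \<mu>) * \<parallel>T w - w\<parallel>\<^sup>2\<close>, where
  \<open>\<mu> * (T w - w) = (xn - xc) - a * (xc - xm)\<close>. The mixed term of that square is split with the weight
  \<open>a + \<delta> * \<mu>\<close>, which makes the coefficient of \<open>\<parallel>xc - xm\<parallel>\<^sup>2\<close> independent of \<open>1 / \<mu>\<close>.\<close>
lemma inertial_step_estimate:
  fixes T :: "'a::real_inner \<Rightarrow> 'a"
  assumes nonexp: "\<And>v w. norm (T v - T w) \<le> norm (v - w)" and p: "T p = p"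
    and a: "0 \<le> a" and mu: "0 < \<mu>" "\<mu> \<le> 1" and "\<delta> > 0"
    and w: "w = xc + a *\<^sub>R (xc - xm)" and xn: "xn = w + \<mu> *\<^sub>R (T w - w)"
  shows "(norm (xn - p))\<^sup>2 \<le> (1 + a) * (norm (xc - p))\<^sup>2 - a * (norm (xm - p))\<^sup>2
     + (a * (1 + a) + a * \<delta> * (1 - \<mu>)) * (norm (xc - xm))\<^sup>2
     - \<delta> * (1 - \<mu>) / (a + \<delta> * \<mu>) * (norm (xn - xc))\<^sup>2"
proof -
  define D E s where "D = xn - xc" and "E = xc - xm" and "s = a + \<delta> * \<mu>"
  have s: "s > 0" using a mu \<open>\<delta> > 0\<close> by (simp add: s_def add_nonneg_pos)
  have "(norm (xn - p))\<^sup>2 = (1 - \<mu>) * (norm (w - p))\<^sup>2 + \<mu> * (norm (T w - p))\<^sup>2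
      - \<mu> * (1 - \<mu>) * (norm (T w - w))\<^sup>2"
    unfolding xn power2_norm_eq_inner
    by (simp add: inner_add_left inner_add_right inner_diff_left inner_diff_right inner_commute
        algebra_simps)
  also have "\<mu> * (norm (T w - p))\<^sup>2 \<le> \<mu> * (norm (w - p))\<^sup>2"
    using nonexp[of w p] p mu by (intro mult_left_mono power_mono) auto
  finally have 1: "(norm (xn - p))\<^sup>2 \<le> (norm (w - p))\<^sup>2 - \<mu> * (1 - \<mu>) * (norm (T w - w))\<^sup>2"
    by (simp add: algebra_simps)
  have 2: "(norm (w - p))\<^sup>2
      = (1 + a) * (norm (xc - p))\<^sup>2 - a * (norm (xm - p))\<^sup>2 + a * (1 + a) * (norm E)\<^sup>2"
    unfolding w E_def power2_norm_eq_inner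
    by (simp add: inner_add_left inner_add_right inner_diff_left inner_diff_right inner_commute
        algebra_simps)
  have "\<mu> *\<^sub>R (T w - w) = D - a *\<^sub>R E"
    unfolding D_def E_def xn by (simp add: w)
  then have 3: "\<mu>\<^sup>2 * (norm (T w - w))\<^sup>2 = (norm (D - a *\<^sub>R E))\<^sup>2"
    by (metis norm_scaleR power2_abs power_mult_distrib)
  \<comment> \<open>Young's inequality with its remainder, so that it is an identity.\<close>
  have "(norm (D - a *\<^sub>R E))\<^sup>2
      = \<delta> * \<mu> / s * (norm D)\<^sup>2 - a * \<delta> * \<mu> * (norm E)\<^sup>2 + a / s * (norm (D - s *\<^sub>R E))\<^sup>2"
  proof -
    define k where "k = a / s"
    have ks: "k * (s * c) = a * c" for c using s by (simp add: k_def)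
    have 4: "a * \<delta> * \<mu> = a * (s - a)" by (simp add: s_def)
    have 5: "\<delta> * \<mu> / s = 1 - k"
      using s by (simp add: k_def s_def field_simps)
    show ?thesis
      unfolding 4 5 power2_norm_eq_inner k_def[symmetric]
      by (simp add: inner_diff_left inner_diff_right inner_commute algebra_simps ks)
  qed
  then have "\<delta> * \<mu> / s * (norm D)\<^sup>2 - a * \<delta> * \<mu> * (norm E)\<^sup>2 \<le> (norm (D - a *\<^sub>R E))\<^sup>2"
    using a s by simp
  also have "\<dots> = \<mu> * (\<mu> * (norm (T w - w))\<^sup>2)"
    unfolding 3[symmetric] by (simp add: power2_eq_square)
  also have "\<delta> * \<mu> / s * (norm D)\<^sup>2 - a * \<delta> * \<mu> * (norm E)\<^sup>2
      = \<mu> * (\<delta> / s * (norm D)\<^sup>2 - a * \<delta> * (norm E)\<^sup>2)"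
    by (simp add: right_diff_distrib)
  finally have "\<delta> / s * (norm D)\<^sup>2 - a * \<delta> * (norm E)\<^sup>2 \<le> \<mu> * (norm (T w - w))\<^sup>2"
    using mu by simp
  then have "(1 - \<mu>) * (\<delta> / s * (norm D)\<^sup>2 - a * \<delta> * (norm E)\<^sup>2) \<le> (1 - \<mu>) * (\<mu> * (norm (T w - w))\<^sup>2)"
    using mu by (intro mult_left_mono) auto
  moreover have "(1 - \<mu>) * (\<delta> / s * (norm D)\<^sup>2 - a * \<delta> * (norm E)\<^sup>2)
      = \<delta> * (1 - \<mu>) / s * (norm D)\<^sup>2 - a * \<delta> * (1 - \<mu>) * (norm E)\<^sup>2"
    by (simp add: algebra_simps)
  moreover have "(1 - \<mu>) * (\<mu> * (norm (T w - w))\<^sup>2) = \<mu> * (1 - \<mu>) * (norm (T w - w))\<^sup>2"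
    by simp
  ultimately show ?thesis
    using 1 2 unfolding D_def[symmetric] E_def[symmetric] s_def[symmetric] distrib_right[of "a * (1 + a)"]
    by linarith
qed

text \<open>For each fixed point \<open>p\<close>, the one-step estimate turns \<open>\<parallel>x n - p\<parallel>\<^sup>2\<close> into a sequence to which
  \<open>inertial_lyapunov_convergence\<close> applies. With \<open>\<tau> = \<alpha> * (1 + \<alpha>) + \<alpha> * \<delta> + \<sigma>\<close>, the upper bound on the
  relaxation parameters says \<open>\<tau> \<le> \<delta> * (1 - \<mu>) / (\<alpha> + \<delta> * \<mu>)\<close>: the gain in \<open>\<parallel>x (n + 1) - x n\<parallel>\<^sup>2\<close> pays
  for its coefficient at the next step and leaves \<open>\<sigma>\<close>. Weak convergence then follows from Opial's
  lemma and demiclosedness.\<close>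
theorem inertial_krasnoselskii_mann:
  fixes T :: "'a::{real_inner, complete_space} \<Rightarrow> 'a" and x w :: "nat \<Rightarrow> 'a"
    and \<alpha>s \<mu> :: "nat \<Rightarrow> real"
  defines "w \<equiv> \<lambda>n. x n + \<alpha>s n *\<^sub>R (x n - x (n - 1))"
  assumes nonexp: "\<And>u v. norm (T u - T v) \<le> norm (u - v)" and "Fix T \<noteq> {}"
    and step: "\<And>n. n \<ge> 1 \<Longrightarrow> x (n + 1) = w n + \<mu> n *\<^sub>R (T (w n) - w n)"
    and mono: "mono_on {1..} \<alpha>s" and bounds: "\<And>n. n \<ge> 1 \<Longrightarrow> 0 \<le> \<alpha>s n \<and> \<alpha>s n \<le> \<alpha>"
    and "\<alpha> < 1" "\<sigma> > 0" "\<delta> > 0" "m > 0" and mu_lower: "\<And>n. n \<ge> 1 \<Longrightarrow> m \<le> \<mu> n"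
    and mu_upper: "\<And>n. n \<ge> 1 \<Longrightarrow> \<mu> n \<le> (\<delta> - \<alpha> * (\<alpha> * (1 + \<alpha>) + \<alpha> * \<delta> + \<sigma>)) /
                         (\<delta> * (1 + \<alpha> * (1 + \<alpha>) + \<alpha> * \<delta> + \<sigma>))"
  shows "summable (\<lambda>n. (norm (x (n + 1) - x n))\<^sup>2)" (is ?summable)
    and "bounded (range x)" (is ?bounded)
    and "(\<lambda>n. w n - x n) \<longlonglongrightarrow> 0" (is ?inertia)
    and "(\<lambda>n. T (w n) - w n) \<longlonglongrightarrow> 0" (is ?residual)
    and "\<exists>p\<in>Fix T. weakly_converges x p" (is ?weak)
proof -
  define a d g where "a n = \<alpha>s (Suc n)" and "d n = (norm (x (Suc n) - x n))\<^sup>2"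
    and "g n = a n * (1 + a n) + a n * \<delta> * (1 - \<mu> (Suc n))" for n
  define \<tau> where "\<tau> = \<alpha> * (1 + \<alpha>) + \<alpha> * \<delta> + \<sigma>"
  have a: "0 \<le> a n" "a n \<le> \<alpha>" for n using bounds[of "Suc n"] by (simp_all add: a_def)
  have alpha0: "0 \<le> \<alpha>" using a order_trans by blast
  have inc: "incseq a"
    using mono by (auto simp: incseq_def a_def mono_on_def)
  have tau0: "\<tau> > 0"
    using alpha0 \<open>\<sigma> > 0\<close> \<open>\<delta> > 0\<close> unfolding \<tau>_def by (intro add_nonneg_pos add_nonneg_nonneg mult_nonneg_nonneg) auto
  have mu0: "0 < \<mu> (Suc n)" for n using mu_lower[of "Suc n"] \<open>m > 0\<close> by simp
  have mu_tau: "(\<alpha> + \<delta> * \<mu> (Suc n)) * \<tau> \<le> \<delta> * (1 - \<mu> (Suc n))" for n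
  proof -
    have "\<mu> (Suc n) \<le> (\<delta> - \<alpha> * \<tau>) / (\<delta> * (1 + \<tau>))"
      using mu_upper[of "Suc n"] by (simp add: \<tau>_def add.assoc)
    then have "\<mu> (Suc n) * (\<delta> * (1 + \<tau>)) \<le> \<delta> - \<alpha> * \<tau>"
      using \<open>\<delta> > 0\<close> tau0 by (simp add: pos_le_divide_eq)
    then show ?thesis by (simp add: algebra_simps)
  qed
  have mu1: "\<mu> (Suc n) \<le> 1" for n
  proof -
    have "0 \<le> (\<alpha> + \<delta> * \<mu> (Suc n)) * \<tau>"
      using alpha0 mu0[of n] \<open>\<delta> > 0\<close> tau0 by (intro mult_nonneg_nonneg add_nonneg_nonneg) auto
    with mu_tau[of n] have "0 \<le> \<delta> * (1 - \<mu> (Suc n))" by linarith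
    then show ?thesis using \<open>\<delta> > 0\<close> by (simp add: zero_le_mult_iff)
  qed
  have tau_le: "\<tau> \<le> \<delta> * (1 - \<mu> (Suc n)) / (a n + \<delta> * \<mu> (Suc n))" for n
  proof -
    have pos: "0 < a n + \<delta> * \<mu> (Suc n)" using a[of n] mu0[of n] \<open>\<delta> > 0\<close> by (simp add: add_nonneg_pos)
    have "\<tau> * (a n + \<delta> * \<mu> (Suc n)) \<le> \<tau> * (\<alpha> + \<delta> * \<mu> (Suc n))"
      using a(2)[of n] tau0 by (intro mult_left_mono) auto
    also have "\<dots> \<le> \<delta> * (1 - \<mu> (Suc n))" using mu_tau[of n] by (simp add: mult.commute)
    finally show ?thesis using pos by (simp add: pos_le_divide_eq)
  qed
  have g0: "0 \<le> g n" for n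
    using a[of n] mu1[of n] \<open>\<delta> > 0\<close> unfolding g_def
    by (intro add_nonneg_nonneg mult_nonneg_nonneg) auto
  have g_le: "g n \<le> \<tau> - \<sigma>" for n
  proof -
    have "a n * (1 + a n) \<le> \<alpha> * (1 + \<alpha>)" using a[of n] alpha0 by (intro mult_mono) auto
    moreover have "a n * \<delta> * (1 - \<mu> (Suc n)) \<le> \<alpha> * \<delta> * 1"
      using a[of n] alpha0 mu0[of n] mu1[of n] \<open>\<delta> > 0\<close> by (intro mult_mono) auto
    ultimately show ?thesis by (simp add: g_def \<tau>_def)
  qed
  have d0: "0 \<le> d n" for n by (simp add: d_def)
  have step': "x (Suc (Suc n)) = w (Suc n) + \<mu> (Suc n) *\<^sub>R (T (w (Suc n)) - w (Suc n))" for n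
    using step[of "Suc n"] by simp
  have w': "w (Suc n) = x (Suc n) + a n *\<^sub>R (x (Suc n) - x n)" for n
    by (simp add: w_def a_def)
  have lyapunov: "summable d \<and> convergent (\<lambda>n. (norm (x n - p))\<^sup>2)" if "p \<in> Fix T" for p
  proof -
    let ?\<phi> = "\<lambda>n. (norm (x n - p))\<^sup>2"
    have Tp: "T p = p" using that by (simp add: Fix_def)
    have descent: "?\<phi> (Suc (Suc n)) - a (Suc n) * ?\<phi> (Suc n) + g (Suc n) * d (Suc n) + \<sigma> * d (Suc n)
      \<le> ?\<phi> (Suc n) - a n * ?\<phi> n + g n * d n" for n
    proof -
      have "?\<phi> (Suc (Suc n)) \<le> (1 + a n) * ?\<phi> (Suc n) - a n * ?\<phi> n + g n * d n
          - \<delta> * (1 - \<mu> (Suc n)) / (a n + \<delta> * \<mu> (Suc n)) * d (Suc n)"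
        unfolding g_def d_def
        by (rule inertial_step_estimate[OF nonexp Tp a(1) mu0 mu1 \<open>\<delta> > 0\<close> w' step'])
      moreover have "(g (Suc n) + \<sigma>) * d (Suc n)
          \<le> \<delta> * (1 - \<mu> (Suc n)) / (a n + \<delta> * \<mu> (Suc n)) * d (Suc n)"
        using g_le[of "Suc n"] tau_le[of n] by (intro mult_right_mono d0) linarith
      moreover have "a n * ?\<phi> (Suc n) \<le> a (Suc n) * ?\<phi> (Suc n)"
        using inc by (intro mult_right_mono) (auto simp: incseq_SucD)
      ultimately show ?thesis by (simp add: distrib_right)
    qed
    show ?thesis
      using inertial_lyapunov_convergence[of ?\<phi> d a \<alpha> g "\<tau> - \<sigma>" \<sigma>,
          OF _ d0 inc a \<open>\<alpha> < 1\<close> g0 g_le \<open>\<sigma> > 0\<close> descent] by simp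
  qed
  obtain p0 where p0: "p0 \<in> Fix T" using \<open>Fix T \<noteq> {}\<close> by blast
  then have sum: "summable d" using lyapunov by blast
  then show ?summable unfolding d_def[abs_def] by simp
  have "Bseq (\<lambda>n. (norm (x n - p0))\<^sup>2)"
    using lyapunov[OF p0] convergent_imp_Bseq by blast
  then obtain K where "K > 0" and K: "\<And>n. norm ((norm (x n - p0))\<^sup>2) \<le> K"
    unfolding Bseq_def by blast
  have M: "norm (x n) \<le> norm p0 + sqrt K" for n
  proof -
    have "norm (x n - p0) \<le> sqrt K" using K[of n] by (simp add: real_le_rsqrt)
    then show ?thesis using norm_triangle_ineq2[of "x n" p0] by linarith
  qed
  then show ?bounded by (auto simp: bounded_iff)
  have "(\<lambda>n. sqrt (d n)) \<longlonglongrightarrow> sqrt 0"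
    using summable_LIMSEQ_zero[OF sum] by (rule tendsto_real_sqrt)
  then have e: "(\<lambda>n. norm (x (Suc n) - x n)) \<longlonglongrightarrow> 0" by (simp add: d_def)
  have inertia_le: "norm (a n *\<^sub>R (x (Suc n) - x n)) \<le> norm (x (Suc n) - x n)" for n
    using a[of n] \<open>\<alpha> < 1\<close> by (simp add: mult_left_le_one_le)
  have "(\<lambda>n. w (Suc n) - x (Suc n)) \<longlonglongrightarrow> 0"
    using inertia_le by (intro Lim_null_comparison[OF _ e] always_eventually allI) (simp add: w')
  then show inertia: ?inertia by (rule LIMSEQ_imp_Suc)
  have "(\<lambda>n. (norm (x (Suc (Suc n)) - x (Suc n)) + norm (x (Suc n) - x n)) / m) \<longlonglongrightarrow> (0 + 0) / m"
    using \<open>m > 0\<close> by (intro tendsto_intros e LIMSEQ_Suc[OF e]) simp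
  then have lim: "(\<lambda>n. (norm (x (Suc (Suc n)) - x (Suc n)) + norm (x (Suc n) - x n)) / m) \<longlonglongrightarrow> 0"
    by simp
  have le: "norm (T (w (Suc n)) - w (Suc n))
      \<le> (norm (x (Suc (Suc n)) - x (Suc n)) + norm (x (Suc n) - x n)) / m" for n
  proof -
    have "\<mu> (Suc n) *\<^sub>R (T (w (Suc n)) - w (Suc n))
        = (x (Suc (Suc n)) - x (Suc n)) - a n *\<^sub>R (x (Suc n) - x n)"
      by (simp add: step' w')
    then have "\<mu> (Suc n) * norm (T (w (Suc n)) - w (Suc n))
        = norm ((x (Suc (Suc n)) - x (Suc n)) - a n *\<^sub>R (x (Suc n) - x n))"
      using mu0[of n] by (metis abs_of_pos norm_scaleR)
    also have "\<dots> \<le> norm (x (Suc (Suc n)) - x (Suc n)) + norm (x (Suc n) - x n)"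
      using norm_triangle_ineq4 inertia_le[of n] by (meson add_left_mono order_trans)
    finally have "\<mu> (Suc n) * norm (T (w (Suc n)) - w (Suc n))
        \<le> norm (x (Suc (Suc n)) - x (Suc n)) + norm (x (Suc n) - x n)" .
    moreover have "m * norm (T (w (Suc n)) - w (Suc n)) \<le> \<mu> (Suc n) * norm (T (w (Suc n)) - w (Suc n))"
      using mu_lower[of "Suc n"] by (intro mult_right_mono) auto
    ultimately show ?thesis using \<open>m > 0\<close> by (simp add: pos_le_divide_eq mult.commute)
  qed
  have "(\<lambda>n. T (w (Suc n)) - w (Suc n)) \<longlonglongrightarrow> 0"
    by (rule Lim_null_comparison[OF always_eventually[OF allI[OF le]] lim])
  then show residual: ?residual by (rule LIMSEQ_imp_Suc)
  have "(\<lambda>n. 2 * norm (w n - x n) + norm (T (w n) - w n)) \<longlonglongrightarrow> 2 * 0 + 0"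
    using inertia residual by (intro tendsto_intros tendsto_norm_zero)
  then have lim: "(\<lambda>n. 2 * norm (w n - x n) + norm (T (w n) - w n)) \<longlonglongrightarrow> 0" by simp
  have le: "norm (norm (x n - T (x n))) \<le> 2 * norm (w n - x n) + norm (T (w n) - w n)" for n
  proof -
    have "x n - T (x n) = (T (w n) - T (x n)) - (w n - x n) - (T (w n) - w n)" by simp
    also have "norm \<dots> \<le> norm (T (w n) - T (x n)) + norm (w n - x n) + norm (T (w n) - w n)"
      using norm_triangle_ineq4[of "T (w n) - T (x n)" "w n - x n"]
        norm_triangle_ineq4[of "(T (w n) - T (x n)) - (w n - x n)" "T (w n) - w n"] by linarith
    finally have "norm (x n - T (x n)) \<le> norm (T (w n) - T (x n)) + norm (w n - x n) + norm (T (w n) - w n)" .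
    then show ?thesis using nonexp[of "w n" "x n"] by simp
  qed
  have fixed: "(\<lambda>n. norm (x n - T (x n))) \<longlonglongrightarrow> 0"
    by (rule Lim_null_comparison[OF always_eventually[OF allI[OF le]] lim])
  show ?weak
  proof (rule opial[OF \<open>Fix T \<noteq> {}\<close> _ _ M])
    fix p assume "p \<in> Fix T" then show "convergent (\<lambda>n. (norm (x n - p))\<^sup>2)" using lyapunov by blast
  next
    fix G q assume G: "G \<le> sequentially" "G \<noteq> bot" "weak_limit x q G"
    have "T q = q"
      by (rule demiclosedness[OF nonexp G(2) _ G(3) tendsto_mono[OF G(1) fixed]])
        (rule always_eventually[OF allI[OF M]])
    then show "q \<in> Fix T" by (simp add: Fix_def)
  qed
qed

section \<open>Graph limits of monotone operators\<close>

lemma inner_bounded_tendsto_zero: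
  fixes f g :: "nat \<Rightarrow> 'a::real_inner"
  assumes "\<forall>\<^sub>F n in F. norm (f n) \<le> M" and "(g \<longlongrightarrow> 0) F"
  shows "((\<lambda>n. inner (f n) (g n)) \<longlongrightarrow> 0) F"
proof (rule Lim_null_comparison)
  show "((\<lambda>n. M * norm (g n)) \<longlongrightarrow> 0) F"
    using tendsto_mult_right_zero[OF tendsto_norm_zero[OF assms(2)]] .
  show "\<forall>\<^sub>F n in F. norm (inner (f n) (g n)) \<le> M * norm (g n)"
    using assms(1)
  proof eventually_elim
    case (elim n)
    then show ?case
      using Cauchy_Schwarz_ineq2[of "f n" "g n"] mult_right_mono[OF elim norm_ge_zero[of "g n"]] by simp
  qed
qed

text \<open>A closedness principle for the sum of two maximally monotone operators: weak limits along both
  graphs are again graph points, provided that the base points merge and the values cancel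
  strongly. With \<open>u n\<close> written as \<open>(u n + v n) - v n\<close>, every product of two varying vectors in
  the sum of the two monotonicity inequalities has a factor \<open>u n + v n\<close> or \<open>y n - z n\<close> that tends
  to \<open>0\<close> in norm, so the inequality passes to the limit.
  It concerns \<open>A\<close> and \<open>B\<close> together; if the limit missed the graph of \<open>B\<close>, a violating point of \<open>B\<close>
  would put it on the graph of \<open>A\<close>, and using that graph point in the inequality contradicts the
  violation.\<close>
lemma maximally_monotone_sum_closed:
  fixes A B :: "'a::real_inner \<Rightarrow> 'a set"
  assumes A: "maximally_monotone A" and B: "maximally_monotone B" and "G \<noteq> bot"
    and u: "\<forall>\<^sub>F n in G. u n \<in> A (z n)" and v: "\<forall>\<^sub>F n in G. v n \<in> B (y n)"
    and bz: "\<forall>\<^sub>F n in G. norm (z n) \<le> M" and bv: "\<forall>\<^sub>F n in G. norm (v n) \<le> N"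
    and yz: "((\<lambda>n. y n - z n) \<longlongrightarrow> 0) G" and uv: "((\<lambda>n. u n + v n) \<longlongrightarrow> 0) G"
    and wy: "weak_limit y q G" and wv: "weak_limit v r G"
  shows "r \<in> B q" "- r \<in> A q"
proof -
  have monA: "monotone_op A" and relA: "\<And>x u. (\<And>y v. v \<in> A y \<Longrightarrow> 0 \<le> inner (x - y) (u - v)) \<Longrightarrow> u \<in> A x"
    using A by (auto simp: maximally_monotone_iff)
  have monB: "monotone_op B" and relB: "\<And>x u. (\<And>y v. v \<in> B y \<Longrightarrow> 0 \<le> inner (x - y) (u - v)) \<Longrightarrow> u \<in> B x"
    using B by (auto simp: maximally_monotone_iff)
  have wz: "weak_limit z q G"
    by (rule weak_limit_perturb[OF wy]) (use tendsto_minus[OF yz] in simp)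
  have key: "0 \<le> inner (q - a) (- r - a') + inner (q - b) (r - b')"
    if "a' \<in> A a" "b' \<in> B b" for a a' b b'
  proof -
    let ?f = "\<lambda>n. inner (z n) (u n + v n) - inner (u n + v n) a + inner (v n) (y n - z n)
      + (inner (v n) a - inner (z n) a' + inner a a') + (inner b b' - inner (y n) b' - inner (v n) b)"
    have "(?f \<longlongrightarrow> 0 - inner 0 a + 0 + (inner r a - inner q a' + inner a a')
        + (inner b b' - inner q b' - inner r b)) G"
      by (intro tendsto_intros inner_bounded_tendsto_zero[OF bz uv] inner_bounded_tendsto_zero[OF bv yz] uv
          wy[unfolded weak_limit_def, rule_format] wz[unfolded weak_limit_def, rule_format]
          wv[unfolded weak_limit_def, rule_format])
    moreover have "\<forall>\<^sub>F n in G. 0 \<le> ?f n"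
      using u v
    proof eventually_elim
      case (elim n)
      have "0 \<le> inner (z n - a) (u n - a') + inner (y n - b) (v n - b')"
        using monotone_opD[OF monA elim(1) that(1)] monotone_opD[OF monB elim(2) that(2)] by simp
      also have "\<dots> = ?f n"
        by (simp add: inner_diff_left inner_diff_right inner_add_left inner_add_right inner_commute)
      finally show ?case .
    qed
    ultimately have "0 \<le> 0 - inner 0 a + 0 + (inner r a - inner q a' + inner a a')
        + (inner b b' - inner q b' - inner r b)"
      using \<open>G \<noteq> bot\<close> by (rule tendsto_lowerbound)
    then show ?thesis
      by (simp add: inner_diff_left inner_diff_right inner_commute)
  qed
  show "r \<in> B q"
  proof (rule ccontr)
    assume "r \<notin> B q"
    then obtain b b' where b: "b' \<in> B b" "inner (q - b) (r - b') < 0"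
      using relB not_le by blast
    have "0 \<le> inner (q - a) (- r - a')" if "a' \<in> A a" for a a'
      using key[OF that b(1)] b(2) by linarith
    then have "- r \<in> A q" by (rule relA)
    from key[OF this b(1)] b(2) show False by simp
  qed
  show "- r \<in> A q"
    using key[OF _ \<open>r \<in> B q\<close>] by (intro relA) simp
qed

text \<open>While \<open>\<parallel>x n - q\<parallel> \<ge> e\<close> the inner product is at least the positive modulus at \<open>e\<close>. Applied to a
  constant sequence this also gives uniqueness of zeros.\<close>
lemma uniformly_monotone_strong_convergence:
  fixes x u :: "nat \<Rightarrow> 'a::real_inner"
  assumes "uniformly_monotone A" and u: "\<forall>\<^sub>F n in sequentially. u n \<in> A (x n)" and a: "a \<in> A q"
    and lim: "(\<lambda>n. inner (x n - q) (u n - a)) \<longlonglongrightarrow> 0"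
  shows "x \<longlonglongrightarrow> q"
proof (rule tendstoI)
  obtain \<phi> :: "real \<Rightarrow> ereal" where mono: "mono_on {0..} \<phi>" and nonneg: "\<And>t. t \<ge> 0 \<Longrightarrow> \<phi> t \<ge> 0"
    and zero: "\<And>t. t \<ge> 0 \<Longrightarrow> \<phi> t = 0 \<longleftrightarrow> t = 0"
    and bound: "\<And>x u y v. u \<in> A x \<Longrightarrow> v \<in> A y \<Longrightarrow> \<phi> (norm (x - y)) \<le> ereal (inner (x - y) (u - v))"
    using assms(1) unfolding uniformly_monotone_def gr_def by auto
  fix e :: real assume "e > 0"
  then have "0 < \<phi> e" using nonneg[of e] zero[of e] by (simp add: order_less_le)
  then obtain r where r: "0 < ereal r" "ereal r < \<phi> e" using ereal_dense2 by blast
  then have "\<forall>\<^sub>F n in sequentially. inner (x n - q) (u n - a) < r"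
    using order_tendstoD(2)[OF lim, of r] by simp
  with u show "\<forall>\<^sub>F n in sequentially. dist (x n) q < e"
  proof eventually_elim
    case (elim n)
    show ?case
    proof (rule ccontr)
      assume "\<not> ?case"
      then have "\<phi> e \<le> \<phi> (norm (x n - q))"
        using \<open>e > 0\<close> by (intro mono_onD[OF mono]) (auto simp: dist_norm)
      also have "\<dots> \<le> ereal (inner (x n - q) (u n - a))" by (rule bound[OF elim(1) a])
      also have "\<dots> < ereal r" using elim(2) by simp
      finally show False using r(2) by simp
    qed
  qed
qed

lemma uniformly_monotone_op_scale_strong_convergence:
  fixes x u :: "nat \<Rightarrow> 'a::real_inner"
  assumes "uniformly_monotone A" and "\<gamma> > 0"
    and u: "\<forall>\<^sub>F n in sequentially. u n \<in> op_scale \<gamma> A (x n)" and a: "a \<in> op_scale \<gamma> A q"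
    and lim: "(\<lambda>n. inner (x n - q) (u n - a)) \<longlonglongrightarrow> 0"
  shows "x \<longlonglongrightarrow> q"
proof (rule uniformly_monotone_strong_convergence[OF assms(1)])
  have "\<gamma> \<noteq> 0" using \<open>\<gamma> > 0\<close> by simp
  note scale_iff = mem_op_scale_iff[OF this]
  show "\<forall>\<^sub>F n in sequentially. (1 / \<gamma>) *\<^sub>R u n \<in> A (x n)" and "(1 / \<gamma>) *\<^sub>R a \<in> A q"
    using u a unfolding scale_iff by blast+
  have "(\<lambda>n. (1 / \<gamma>) * inner (x n - q) (u n - a)) \<longlonglongrightarrow> 0"
    using tendsto_mult_right_zero[OF lim] .
  then show "(\<lambda>n. inner (x n - q) ((1 / \<gamma>) *\<^sub>R u n - (1 / \<gamma>) *\<^sub>R a)) \<longlonglongrightarrow> 0"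
    by (simp only: scaleR_diff_right[symmetric] inner_scaleR_right)
qed

section \<open>Douglas-Rachford splitting\<close>

lemma Fix_reflected_resolvents_iff:
  fixes A B :: "'a::{real_inner, complete_space} \<Rightarrow> 'a set"
  assumes "maximally_monotone A"
  shows "p \<in> Fix (reflected_resolvent A \<circ> reflected_resolvent B)
    \<longleftrightarrow> resolvent B p - p \<in> A (resolvent B p)"
proof -
  let ?q = "resolvent B p"
  have "p \<in> Fix (reflected_resolvent A \<circ> reflected_resolvent B)
      \<longleftrightarrow> 2 *\<^sub>R resolvent A (2 *\<^sub>R ?q - p) = 2 *\<^sub>R ?q"
    by (simp add: Fix_def reflected_resolvent_def algebra_simps)
  also have "\<dots> \<longleftrightarrow> resolvent A (2 *\<^sub>R ?q - p) = ?q" by simp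
  also have "\<dots> \<longleftrightarrow> ?q - p \<in> A ?q"
    by (simp add: resolvent_eq_iff[OF assms] scaleR_2)
  finally show ?thesis .
qed

lemma zer_op_plus_iff:
  fixes A B :: "'a::real_inner \<Rightarrow> 'a set"
  assumes "\<gamma> > 0"
  shows "q \<in> zer (op_plus A B) \<longleftrightarrow> (\<exists>v. v \<in> op_scale \<gamma> B q \<and> - v \<in> op_scale \<gamma> A q)"
proof
  assume "q \<in> zer (op_plus A B)"
  then obtain u v where "u \<in> A q" "v \<in> B q" "0 = u + v" by (auto simp: zer_def op_plus_def)
  then have "- v \<in> A q" by (simp add: eq_neg_iff_add_eq_0[symmetric])
  with \<open>v \<in> B q\<close> show "\<exists>v. v \<in> op_scale \<gamma> B q \<and> - v \<in> op_scale \<gamma> A q"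
    using assms by (intro exI[of _ "\<gamma> *\<^sub>R v"]) (simp add: mem_op_scale_iff)
next
  assume "\<exists>v. v \<in> op_scale \<gamma> B q \<and> - v \<in> op_scale \<gamma> A q"
  then obtain v where "(1 / \<gamma>) *\<^sub>R v \<in> B q" "- ((1 / \<gamma>) *\<^sub>R v) \<in> A q"
    using assms by (auto simp: mem_op_scale_iff)
  then show "q \<in> zer (op_plus A B)"
    unfolding zer_def op_plus_def using add.left_inverse by (metis (mono_tags, lifting) mem_Collect_eq)
qed

theorem theorem8:
  fixes A B :: "'a::{real_inner, complete_space} \<Rightarrow> 'a set"
    and x y z :: "nat \<Rightarrow> 'a"
    and \<alpha>s lams :: "nat \<Rightarrow> real"
    and \<alpha> \<gamma> lam \<sigma> \<delta> :: real
  assumes "maximally_monotone A" and "maximally_monotone B"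
    and "zer (op_plus A B) \<noteq> {}"
    and "\<gamma> > 0"
    and y: "\<forall>n\<ge>1. y n = resolvent (op_scale \<gamma> B) (x n + \<alpha>s n *\<^sub>R (x n - x (n - 1)))"
    and z: "\<forall>n\<ge>1. z n = resolvent (op_scale \<gamma> A)
                             (2 *\<^sub>R y n - x n - \<alpha>s n *\<^sub>R (x n - x (n - 1)))"
    and x: "\<forall>n\<ge>1. x (n + 1) = x n + \<alpha>s n *\<^sub>R (x n - x (n - 1)) + lams n *\<^sub>R (z n - y n)"
    and "mono_on {1..} \<alpha>s" and "\<alpha>s 1 = 0"
    and "\<forall>n\<ge>1. 0 \<le> \<alpha>s n \<and> \<alpha>s n \<le> \<alpha>" and "\<alpha> < 1"
    and "lam > 0" and "\<sigma> > 0" and "\<delta> > 0"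
    and "\<delta> > (\<alpha>\<^sup>2 * (1 + \<alpha>) + \<alpha> * \<sigma>) / (1 - \<alpha>\<^sup>2)"
    and "\<forall>n\<ge>1. lam \<le> lams n \<and>
           lams n \<le> 2 * ((\<delta> - \<alpha> * (\<alpha> * (1 + \<alpha>) + \<alpha> * \<delta> + \<sigma>)) /
                         (\<delta> * (1 + \<alpha> * (1 + \<alpha>) + \<alpha> * \<delta> + \<sigma>)))"
  shows "\<exists>p \<in> Fix (reflected_resolvent (op_scale \<gamma> A) \<circ> reflected_resolvent (op_scale \<gamma> B)).
      resolvent (op_scale \<gamma> B) p \<in> zer (op_plus A B) \<and>
      summable (\<lambda>n. (norm (x (n + 1) - x n))\<^sup>2) \<and>
      weakly_converges x p \<and>
      (\<lambda>n. y n - z n) \<longlonglongrightarrow> 0 \<and>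
      weakly_converges y (resolvent (op_scale \<gamma> B) p) \<and>
      weakly_converges z (resolvent (op_scale \<gamma> B) p) \<and>
      (uniformly_monotone A \<or> uniformly_monotone B \<longrightarrow>
         (\<exists>q. zer (op_plus A B) = {q} \<and> y \<longlonglongrightarrow> q \<and> z \<longlonglongrightarrow> q))"
proof -
  define A' B' where "A' = op_scale \<gamma> A" and "B' = op_scale \<gamma> B"
  define T where "T = reflected_resolvent A' \<circ> reflected_resolvent B'"
  define w where "w = (\<lambda>n. x n + \<alpha>s n *\<^sub>R (x n - x (n - 1)))"
  have A': "maximally_monotone A'" and B': "maximally_monotone B'"
    using assms(1,2,4) by (simp_all add: A'_def B'_def maximally_monotone_op_scale)
  have monA: "monotone_op A'" and monB: "monotone_op B'"
    using A' B' by (simp_all add: maximally_monotone_iff)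
  have y_eq: "y n = resolvent B' (w n)" if "n \<ge> 1" for n
    using y that by (simp add: B'_def w_def)
  have z_eq: "z n = resolvent A' (2 *\<^sub>R y n - w n)" if "n \<ge> 1" for n
    using z that by (simp add: A'_def w_def diff_diff_eq)
  have T_diff: "T (w n) - w n = 2 *\<^sub>R (z n - y n)" if "n \<ge> 1" for n
    using y_eq[OF that] z_eq[OF that]
    by (simp add: T_def reflected_resolvent_def algebra_simps)
  have nonexp: "norm (T u - T v) \<le> norm (u - v)" for u v
    using reflected_resolvent_nonexpansive[OF A'] reflected_resolvent_nonexpansive[OF B']
    unfolding T_def comp_def by (meson order_trans)
  have fix_iff: "p \<in> Fix T \<longleftrightarrow> resolvent B' p - p \<in> A' (resolvent B' p)" for p
    unfolding T_def by (rule Fix_reflected_resolvents_iff[OF A'])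
  have zer_iff: "q \<in> zer (op_plus A B) \<longleftrightarrow> (\<exists>v. v \<in> B' q \<and> - v \<in> A' q)" for q
    unfolding A'_def B'_def by (rule zer_op_plus_iff[OF assms(4)])
  have fix_nonempty: "Fix T \<noteq> {}"
  proof -
    obtain q v where v: "v \<in> B' q" "- v \<in> A' q" using assms(3) zer_iff by blast
    then have "resolvent B' (q + v) = q" by (simp add: resolvent_eq_iff[OF B'])
    then have "q + v \<in> Fix T" using v by (simp add: fix_iff)
    then show ?thesis by blast
  qed
  have step: "x (n + 1) = w n + (lams n / 2) *\<^sub>R (T (w n) - w n)" if "n \<ge> 1" for n
    using x that unfolding T_diff[OF that] by (simp add: w_def)
  have upper: "lams n / 2 \<le> (\<delta> - \<alpha> * (\<alpha> * (1 + \<alpha>) + \<alpha> * \<delta> + \<sigma>)) /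
                         (\<delta> * (1 + \<alpha> * (1 + \<alpha>) + \<alpha> * \<delta> + \<sigma>))" if "n \<ge> 1" for n
  proof -
    have "l / 2 \<le> c" if "l \<le> 2 * c" for l c :: real using that by simp
    from this[OF conjunct2[OF assms(16)[rule_format, OF that]]] show ?thesis .
  qed
  have lower: "lam / 2 \<le> lams n / 2" if "n \<ge> 1" for n using assms(16) that by simp
  have bounds: "0 \<le> \<alpha>s n \<and> \<alpha>s n \<le> \<alpha>" if "n \<ge> 1" for n using assms(10)[rule_format, OF that] .
  have lam2: "lam / 2 > 0" using assms(12) by simp
  have w_eq: "x n + \<alpha>s n *\<^sub>R (x n - x (n - 1)) = w n" for n by (simp add: w_def)
  note km = inertial_krasnoselskii_mann[where T = T and x = x and \<alpha>s = \<alpha>s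
      and \<mu> = "\<lambda>n. lams n / 2", unfolded w_eq, OF nonexp fix_nonempty step assms(8) bounds
      assms(11,13,14) lam2 lower upper]
  obtain p where p: "p \<in> Fix T" and weak_x: "weakly_converges x p" using km(5) by blast
  define q where "q = resolvent B' p"
  have qB: "p - q \<in> B' q" unfolding q_def by (rule resolvent_mem[OF B'])
  have qA: "- (p - q) \<in> A' q" using p by (simp add: fix_iff q_def)
  have q_zer: "q \<in> zer (op_plus A B)" using qA qB zer_iff by blast

  have yz_eq: "y n - z n = (- 1 / 2) *\<^sub>R (T (w n) - w n)" if "n \<ge> 1" for n
    by (simp add: T_diff[OF that])
  have yz: "(\<lambda>n. y n - z n) \<longlonglongrightarrow> 0"
  proof (rule Lim_transform_eventually)
    show "(\<lambda>n. (- 1 / 2) *\<^sub>R (T (w n) - w n)) \<longlonglongrightarrow> 0"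
      using tendsto_scaleR[OF tendsto_const km(4), of "- 1 / 2"] by simp
    show "\<forall>\<^sub>F n in sequentially. (- 1 / 2) *\<^sub>R (T (w n) - w n) = y n - z n"
      using eventually_ge_at_top[of 1] by eventually_elim (simp add: yz_eq)
  qed

  \<comment> \<open>The values of \<open>A'\<close> at \<open>z n\<close> and of \<open>B'\<close> at \<open>y n\<close> that the two resolvent steps select.\<close>
  define u v where "u n = 2 *\<^sub>R y n - w n - z n" and "v n = w n - y n" for n
  have uA: "u n \<in> A' (z n)" if "n \<ge> 1" for n
    unfolding u_def z_eq[OF that] by (rule resolvent_mem[OF A'])
  have vB: "v n \<in> B' (y n)" if "n \<ge> 1" for n
    unfolding v_def y_eq[OF that] by (rule resolvent_mem[OF B'])
  have uv: "u n + v n = y n - z n" for n by (simp add: u_def v_def scaleR_2)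

  obtain M\<^sub>x where M\<^sub>x: "\<And>n. norm (x n) \<le> M\<^sub>x"
    using km(2) by (auto simp: bounded_iff)
  have "Bseq (\<lambda>n. w n - x n)" using km(3) convergentI convergent_imp_Bseq by blast
  then obtain M\<^sub>d where M\<^sub>d: "\<And>n. norm (w n - x n) \<le> M\<^sub>d" unfolding Bseq_def by blast
  define M where "M = M\<^sub>x + M\<^sub>d"
  have M: "norm (w n) \<le> M" for n
    using norm_triangle_ineq[of "x n" "w n - x n"] M\<^sub>x[of n] M\<^sub>d[of n] by (simp add: M_def)
  have "norm (y n) \<le> norm q + (M + norm p)" if "n \<ge> 1" for n
    using resolvent_nonexpansive[OF B', of "w n" p] norm_triangle_ineq2[of "y n" q]
      norm_triangle_ineq4[of "w n" p] M[of n]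
    by (simp add: y_eq[OF that] q_def)
  then obtain N where N: "\<And>n. n \<ge> 1 \<Longrightarrow> norm (y n) \<le> N" by blast
  have "Bseq (\<lambda>n. y n - z n)" using yz convergentI convergent_imp_Bseq by blast
  then obtain K where K: "\<And>n. norm (y n - z n) \<le> K" unfolding Bseq_def by blast
  have z_bound: "norm (z n) \<le> N + K" if "n \<ge> 1" for n
    using N[OF that] K[of n] norm_triangle_ineq4[of "y n" "y n - z n"] by simp
  have v_bound: "norm (v n) \<le> M + N" if "n \<ge> 1" for n
    using M[of n] N[OF that] norm_triangle_ineq4[of "w n" "y n"] by (simp add: v_def)

  have weak_w: "weak_limit w p sequentially"
    using weak_x weak_limit_perturb[OF _ km(3)] unfolding weak_limit_def weakly_converges_def by blast
  have weak_y: "weakly_converges y q"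
  proof (rule weakly_converges_of_unique_weak_limit)
    show "\<forall>\<^sub>F n in sequentially. norm (y n) \<le> N"
      using eventually_ge_at_top[of 1] by eventually_elim (rule N)
  next
    fix G r assume G: "G \<le> sequentially" "G \<noteq> bot" "weak_limit y r G"
    have ev: "\<forall>\<^sub>F n in G. n \<ge> 1" using G(1) eventually_ge_at_top by (rule filter_leD)
    have "weak_limit v (p - r) G"
      using weak_limit_filter_mono[OF weak_w G(1)] G(3)
      unfolding weak_limit_def v_def inner_diff_left by (auto intro: tendsto_diff)
    then have "p - r \<in> B' r"
      using maximally_monotone_sum_closed(1)[OF A' B' G(2), of u z v y "N + K" "M + N" r "p - r"]
        eventually_mono[OF ev uA] eventually_mono[OF ev vB] eventually_mono[OF ev z_bound]
        eventually_mono[OF ev v_bound] tendsto_mono[OF G(1) yz] G(3)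
      by (simp add: uv)
    then show "r = q" unfolding q_def using resolvent_eq_iff[OF B', of p r] by simp
  qed
  have weak_z: "weakly_converges z q"
  proof -
    have "(\<lambda>n. z n - y n) \<longlonglongrightarrow> 0" using tendsto_minus[OF yz] by simp
    then show ?thesis
      using weak_y weak_limit_perturb[of y q sequentially z]
      unfolding weak_limit_def weakly_converges_def by blast
  qed

  have strong: "\<exists>q. zer (op_plus A B) = {q} \<and> y \<longlonglongrightarrow> q \<and> z \<longlonglongrightarrow> q"
    if uniform: "uniformly_monotone A \<or> uniformly_monotone B"
  proof -
    have strongA: "s \<longlonglongrightarrow> r"
      if "uniformly_monotone A" "\<forall>\<^sub>F n in sequentially. t n \<in> A' (s n)" "a \<in> A' r"
        "(\<lambda>n. inner (s n - r) (t n - a)) \<longlonglongrightarrow> 0" for s t a r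
      using that(2-) uniformly_monotone_op_scale_strong_convergence[OF that(1) assms(4)]
      unfolding A'_def by blast
    have strongB: "s \<longlonglongrightarrow> r"
      if "uniformly_monotone B" "\<forall>\<^sub>F n in sequentially. t n \<in> B' (s n)" "a \<in> B' r"
        "(\<lambda>n. inner (s n - r) (t n - a)) \<longlonglongrightarrow> 0" for s t a r
      using that(2-) uniformly_monotone_op_scale_strong_convergence[OF that(1) assms(4)]
      unfolding B'_def by blast
    have unique: "q' = q" if q': "q' \<in> zer (op_plus A B)" for q'
    proof -
      obtain c where c: "c \<in> B' q'" "- c \<in> A' q'" using q' zer_iff by blast
      have "0 \<le> inner (q' - q) (- c - - (p - q))" "0 \<le> inner (q' - q) (c - (p - q))"
        using monotone_opD[OF monA c(2) qA] monotone_opD[OF monB c(1) qB] by simp_all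
      moreover have "inner (q' - q) (- c - - (p - q)) = - inner (q' - q) (c - (p - q))"
        by (simp add: inner_diff_right)
      ultimately have zero: "inner (q' - q) (- c - - (p - q)) = 0" "inner (q' - q) (c - (p - q)) = 0"
        by linarith+
      \<comment> \<open>Both gaps between the zeros vanish, so the constant sequence \<open>q'\<close> converges to \<open>q\<close>.\<close>
      have "(\<lambda>n :: nat. q') \<longlonglongrightarrow> q"
        using uniform
      proof
        assume "uniformly_monotone A"
        then show ?thesis
          by (rule strongA[where t = "\<lambda>_. - c", OF _ _ qA]) (use c zero in simp_all)
      next
        assume "uniformly_monotone B"
        then show ?thesis
          by (rule strongB[where t = "\<lambda>_. c", OF _ _ qB]) (use c zero in simp_all)
      qed
      then show ?thesis by (simp add: LIMSEQ_const_iff)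
    qed
    let ?a = "\<lambda>n. inner (z n - q) (u n - - (p - q))" and ?b = "\<lambda>n. inner (y n - q) (v n - (p - q))"
    have ge1: "\<forall>\<^sub>F n in sequentially. n \<ge> (1 :: nat)" by (rule eventually_ge_at_top)
    have uA': "\<forall>\<^sub>F n in sequentially. u n \<in> A' (z n)" and vB': "\<forall>\<^sub>F n in sequentially. v n \<in> B' (y n)"
      using eventually_mono[OF ge1 uA] eventually_mono[OF ge1 vB] by simp_all
    have a0: "\<forall>\<^sub>F n in sequentially. 0 \<le> ?a n" and b0: "\<forall>\<^sub>F n in sequentially. 0 \<le> ?b n"
      using eventually_mono[OF uA' monotone_opD[OF monA _ qA]]
        eventually_mono[OF vB' monotone_opD[OF monB _ qB]] by simp_all
    \<comment> \<open>The sum of the two gaps only involves inner products with \<open>y n - z n\<close>.\<close>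
    have "(\<lambda>n. inner (z n) (y n - z n) - inner q (y n - z n) + (inner (v n) (y n - z n)
        - inner (p - q) (y n - z n))) \<longlonglongrightarrow> 0 - inner q 0 + (0 - inner (p - q) 0)"
      by (intro tendsto_intros yz inner_bounded_tendsto_zero[OF eventually_mono[OF ge1 z_bound] yz]
          inner_bounded_tendsto_zero[OF eventually_mono[OF ge1 v_bound] yz])
    moreover have "inner (z n) (y n - z n) - inner q (y n - z n) + (inner (v n) (y n - z n)
        - inner (p - q) (y n - z n)) = ?a n + ?b n" for n
    proof -
      have u: "u n - - (p - q) = (y n - z n) - (v n - (p - q))" using uv[of n] by (simp add: algebra_simps)
      show ?thesis
        unfolding u by (simp add: inner_diff_left inner_diff_right inner_commute)
    qed
    ultimately have ab: "(\<lambda>n. ?a n + ?b n) \<longlonglongrightarrow> 0" by simp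
    have a_lim: "?a \<longlonglongrightarrow> 0" and b_lim: "?b \<longlonglongrightarrow> 0"
    proof -
      have "\<forall>\<^sub>F n in sequentially. ?a n \<le> ?a n + ?b n" using b0 by eventually_elim simp
      then show "?a \<longlonglongrightarrow> 0" by (rule tendsto_sandwich[OF a0 _ tendsto_const ab])
      have "\<forall>\<^sub>F n in sequentially. ?b n \<le> ?a n + ?b n" using a0 by eventually_elim simp
      then show "?b \<longlonglongrightarrow> 0" by (rule tendsto_sandwich[OF b0 _ tendsto_const ab])
    qed
    have "y \<longlonglongrightarrow> q \<and> z \<longlonglongrightarrow> q"
      using uniform
    proof
      assume "uniformly_monotone A"
      then have zq: "z \<longlonglongrightarrow> q" by (rule strongA[OF _ uA' qA a_lim])
      with tendsto_add[OF yz zq] show ?thesis by simp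
    next
      assume "uniformly_monotone B"
      then have yq: "y \<longlonglongrightarrow> q" by (rule strongB[OF _ vB' qB b_lim])
      with tendsto_diff[OF yq yz] show ?thesis by simp
    qed
    moreover have "zer (op_plus A B) = {q}" using unique q_zer by blast
    ultimately show ?thesis by blast
  qed
  show ?thesis
    using p q_zer km(1) weak_x yz weak_y weak_z strong
    unfolding T_def A'_def B'_def q_def by blast
qed

end
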